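(* Let $C>0$. There is a constant $C'>0$ depending only on $C$ such that the following holds for all $d,M,m\in\mathbb{N}$, with $N=(2M+1)^d$. Let $\mathbf{X}=\{x^1,\dots,x^m\}\subset\mathbb{T}^d$, let $\|\cdot\|_Y$ be a norm, and let $T_{\mathbf{X}}:C(\mathbb{T}^d)\to L_2(\mathbb{T}^d)$ be a recovery map of the form $T_{\mathbf{X}}(f)=T(f(\mathbf{X}))$ with a map $T:\mathbb{C}^m\to L_2(\mathbb{T}^d)$. If $$\|f-T_{\mathbf{X}}(f)\|_{L_2}\ \le\ C\bigl(\sigma_{2n}(f;\mathcal{T}^d)_{L_\infty}+E_{Q_M}(f)_Y\bigr)$$ for every $f\in C(\mathbb{T}^d)$ and $n\in\mathbb{N}$, then the number of required samples satisfies $$m\ \ge\ n\,\frac{\log\bigl(N/(4n)\bigr)}{4\log\bigl(C'd\log(N)\bigr)}\qquad\text{for all } n\in\mathbb{N}.$$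
   Context: $\mathbb{T}^d$ is the $d$-dimensional torus, identified with $[0,1]^d$ and equipped with Lebesgue measure, and $\mathcal{T}^d=\{\exp(2\pi\mathrm{i}\,\mathbf{k}\cdot\,): \mathbf{k}\in\mathbb{Z}^d\}$ is the multivariate trigonometric system. $C(\mathbb{T}^d)$ are the continuous complex-valued functions and $f(\mathbf{X})=(f(x^1),\dots,f(x^m))$. $\sigma_{k}(f;\mathcal{T}^d)_{L_\infty}=\inf_{K\subset\mathbb{Z}^d,\,|K|\le k}\inf_{c_{\mathbf{k}}\in\mathbb{C}}\|f-\sum_{\mathbf{k}\in K}c_{\mathbf{k}}\exp(2\pi\mathrm{i}\,\mathbf{k}\cdot)\|_{L_\infty}$ is the best $k$-term approximation error in $L_\infty$. $Q_M=[-M,M]^d\cap\mathbb{Z}^d$, $\mathcal{T}(Q_M)=\mathrm{span}_{\mathbb{C}}\{\exp(2\pi\mathrm{i}\,\mathbf{k}\cdot):\mathbf{k}\in Q_M\}$, and $E_{Q_M}(f)_Y=\inf_{g\in\mathcal{T}(Q_M)}\|f-g\|_Y$, where $\|\cdot\|_Y$ is some norm on (a space containing) $C(\mathbb{T}^d)$. $\log$ is the natural logarithm. *)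

theory Defs
  imports "HOL-Analysis.Analysis" "HOL-Probability.Essential_Supremum"
begin

text \<open>The dimension is quantified inside the theorem (the constant must not depend on it), so it is
  a natural number here: points of real \<open>d\<close>-space are given by the coordinates \<open>i < d\<close> of a function
  of type \<open>nat \<Rightarrow> real\<close>, frequencies by extensional functions of type \<open>nat \<Rightarrow> int\<close>.\<close>

type_synonym torus_fun = "(nat \<Rightarrow> real) \<Rightarrow> complex"

text \<open>The completion makes this Lebesgue (rather than Borel) measure on the cube. The boundary
  faces that the torus identifies are null sets.\<close>

definition torus :: "nat \<Rightarrow> (nat \<Rightarrow> real) measure" where
  "torus d = completion (PiM {..<d} (\<lambda>_. restrict_space lborel {0..1}))"

text \<open>A function on the torus is a function of the coordinates \<open>i < d\<close> that has period 1 in each of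
  them; it is continuous on the torus iff it is continuous for the product topology
  on \<open>nat \<Rightarrow> real\<close>. As such functions are defined everywhere, equality and the vector space
  operations are the pointwise ones.\<close>

definition torus_continuous :: "nat \<Rightarrow> torus_fun set" where
  "torus_continuous d =
     {f. continuous_on UNIV f \<and> (\<forall>x y. (\<forall>i<d. x i - y i \<in> \<int>) \<longrightarrow> f x = f y)}"

text \<open>Representatives of the elements of \<open>L\<^sub>2\<close>; they need not be periodic, since only their
  restriction to the cube matters.\<close>

definition torus_L2 :: "nat \<Rightarrow> torus_fun set" where
  "torus_L2 d = {f \<in> borel_measurable (torus d). integrable (torus d) (\<lambda>x. (cmod (f x))\<^sup>2)}"

definition L2_norm :: "nat \<Rightarrow> torus_fun \<Rightarrow> real" where
  "L2_norm d f = sqrt (LINT x|torus d. (cmod (f x))\<^sup>2)"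

text \<open>Only used for essentially bounded functions, where the essential supremum is finite.\<close>

definition Linf_norm :: "nat \<Rightarrow> torus_fun \<Rightarrow> real" where
  "Linf_norm d f = real_of_ereal (esssup (torus d) (\<lambda>x. ereal (cmod (f x))))"

definition frequencies :: "nat \<Rightarrow> (nat \<Rightarrow> int) set" where
  "frequencies d = {..<d} \<rightarrow>\<^sub>E UNIV"

definition freq_cube :: "nat \<Rightarrow> nat \<Rightarrow> (nat \<Rightarrow> int) set" where
  "freq_cube d M = {..<d} \<rightarrow>\<^sub>E {- int M..int M}"

definition trig :: "nat \<Rightarrow> (nat \<Rightarrow> int) \<Rightarrow> torus_fun" where
  "trig d k x = exp (2 * complex_of_real pi * \<i> * complex_of_real (\<Sum>i<d. of_int (k i) * x i))"

definition trig_poly :: "nat \<Rightarrow> (nat \<Rightarrow> int) set \<Rightarrow> ((nat \<Rightarrow> int) \<Rightarrow> complex) \<Rightarrow> torus_fun" where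
  "trig_poly d K c x = (\<Sum>k\<in>K. c k * trig d k x)"

definition trig_span :: "nat \<Rightarrow> nat \<Rightarrow> torus_fun set" where
  "trig_span d M = range (trig_poly d (freq_cube d M))"

definition best_term_approx :: "nat \<Rightarrow> nat \<Rightarrow> torus_fun \<Rightarrow> real" where
  "best_term_approx d s f =
     Inf {Linf_norm d (\<lambda>x. f x - trig_poly d K c x) | K c.
            K \<subseteq> frequencies d \<and> finite K \<and> card K \<le> s}"

text \<open>A norm on a space containing the continuous functions enters only through its restriction
  to them, which is a norm on this complex vector space; no relation to the other norms is required.\<close>

definition norm_on_continuous :: "nat \<Rightarrow> (torus_fun \<Rightarrow> real) \<Rightarrow> bool" where
  "norm_on_continuous d Y \<longleftrightarrow>
     (\<forall>f\<in>torus_continuous d. 0 \<le> Y f \<and> (Y f = 0 \<longleftrightarrow> f = (\<lambda>_. 0))) \<and>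
     (\<forall>f\<in>torus_continuous d. \<forall>c. Y (\<lambda>x. c * f x) = cmod c * Y f) \<and>
     (\<forall>f\<in>torus_continuous d. \<forall>g\<in>torus_continuous d. Y (\<lambda>x. f x + g x) \<le> Y f + Y g)"

definition best_cube_approx :: "nat \<Rightarrow> nat \<Rightarrow> (torus_fun \<Rightarrow> real) \<Rightarrow> torus_fun \<Rightarrow> real" where
  "best_cube_approx d M Y f = (INF g\<in>trig_span d M. Y (\<lambda>x. f x - g x))"

definition samples :: "nat \<Rightarrow> (nat \<Rightarrow> nat \<Rightarrow> real) \<Rightarrow> torus_fun \<Rightarrow> (nat \<Rightarrow> complex)" where
  "samples m X f = (\<lambda>j\<in>{..<m}. f (X j))"

end

theory Submission
  imports Defs "HOL-Probability.Hoeffding" "HOL-Probability.Infinite_Product_Measure"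
begin

text \<open>Applying the hypothesis to 0 and to a polynomial \<open>h\<close> with frequencies in the cube that vanishes
  at the sample points gives the null space property
  \<open>\<parallel>h\<parallel>\<^sub>2 \<le> C \<sigma>\<^sub>2\<^sub>n(h)\<close>. Hence, in the quotient by all these \<open>h\<close>, a \<open>2n\<close>-sparse polynomial
  has quotient supremum norm at least a constant times its \<open>L\<^sub>2\<close> norm. There are at least
  \<open>(N/4n)\<^bsup>n/2\<^esup>\<close> sets of \<open>n\<close> frequencies that pairwise share at most \<open>n/2\<close> elements; on each of
  them, random signs give a polynomial of supremum norm \<open>O(sqrt (n d log N))\<close>, and the differences of
  these polynomials have \<open>L\<^sub>2\<close> norm at least \<open>sqrt n\<close>. As the quotient has real dimension at most
  \<open>2m\<close>, packing bounds their number by \<open>(C' d log N)\<^bsup>2m\<^esup>\<close>; taking logarithms gives the claim.\<close>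

subsection \<open>Packing in quotients of function spaces\<close>

text \<open>As \<open>T\<close> is an arbitrary map, information comes only from functions with the
  same samples; hence everything is read modulo the polynomials that vanish at the sample points.
  The lower bound on the quotient norm comes from testing the null space property on h = p - u,
  where p is sparse and u has the same samples as p: p itself is a competitor in \<sigma>, so the
  error is at most the supremum of |u|. Here p is the difference of two polynomials with n terms
  each, which is why 2n terms occur. The radius and the separation of the packing are both of order
  sqrt n, so their ratio is free of n. The 4 in front of log(C' d log N) is 2 from the overlap n/2
  times 2 from the real dimension 2m; the 4 in N/(4n) is the price of bounding a binomial
  coefficient by 2^n. The factor d enters through a grid of at most N^(5d) points of the cube, on
  which one choice of signs has to work simultaneously.\<close>

lemma bound_of_power_bound:
  fixes x y K :: real
  assumes "y > 0" and "\<And>s. x ^ s \<le> K * y ^ s"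
  shows "x \<le> y"
proof (rule ccontr)
  assume "\<not> x \<le> y"
  then have "1 < x / y" using \<open>y > 0\<close> by simp
  then obtain s where "K < (x / y) ^ s" using real_arch_pow by blast
  then have "K * y ^ s < x ^ s" using \<open>y > 0\<close> by (simp add: power_divide field_simps)
  with assms(2)[of s] show False by simp
qed

text \<open>Suprema are taken over \<open>D\<close> only, while membership and equality concern
  functions on the whole type. Boundedness makes these suprema finite; the dimension of the quotient
  is limited by the number of sample points alone.\<close>

locale bounded_function_space =
  fixes V :: "('a \<Rightarrow> complex) set" and D :: "'a set"
  assumes zero: "(\<lambda>_. 0) \<in> V"
    and add: "\<And>f g. f \<in> V \<Longrightarrow> g \<in> V \<Longrightarrow> (\<lambda>x. f x + g x) \<in> V"
    and scale: "\<And>f c. f \<in> V \<Longrightarrow> (\<lambda>x. c * f x) \<in> V"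
    and bounded: "\<And>f. f \<in> V \<Longrightarrow> \<exists>B. \<forall>x\<in>D. cmod (f x) \<le> B"
begin

lemma diff: "f \<in> V \<Longrightarrow> g \<in> V \<Longrightarrow> (\<lambda>x. f x - g x) \<in> V"
  using add[OF _ scale[of g "-1"], of f] by simp

text \<open>In the quotient, the supremum norm is equivalent to the largest sample value, and
  \<open>K\<close> is the constant of this equivalence. Induction on the points: either the value at
  a new point is determined by the values at the earlier ones, or some \<open>e\<close> vanishes at
  those, equals 1 at the new point, and corrects the interpolant. Nothing controls the size of
  \<open>e\<close>, hence none of the later bounds may depend on \<open>K\<close>.\<close>

lemma small_interpolant_ex:
  fixes m :: nat
  assumes "X ` {..<m} \<subseteq> D"
  shows "\<exists>K\<ge>0. \<forall>f\<in>V. \<forall>s\<ge>0. (\<forall>j<m. cmod (f (X j)) \<le> s) \<longrightarrow>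
           (\<exists>g\<in>V. (\<forall>j<m. g (X j) = f (X j)) \<and> (\<forall>x\<in>D. cmod (g x) \<le> K * s))"
  using assms
proof (induction m)
  case 0
  show ?case
    by (intro exI[of _ 0]) (auto intro!: bexI[OF _ zero])
next
  case (Suc m)
  have "X ` {..<m} \<subseteq> D" and Xm: "X m \<in> D"
    using Suc.prems by auto
  with Suc.IH obtain K where "K \<ge> 0" and
    K: "\<And>f s. f \<in> V \<Longrightarrow> s \<ge> 0 \<Longrightarrow> (\<forall>j<m. cmod (f (X j)) \<le> s) \<Longrightarrow>
           (\<exists>g\<in>V. (\<forall>j<m. g (X j) = f (X j)) \<and> (\<forall>x\<in>D. cmod (g x) \<le> K * s))"
    by blast
  show ?case
  proof (cases "\<exists>e\<in>V. (\<forall>j<m. e (X j) = 0) \<and> e (X m) \<noteq> 0")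
    case False
    have "\<exists>g\<in>V. (\<forall>j<Suc m. g (X j) = f (X j)) \<and> (\<forall>x\<in>D. cmod (g x) \<le> K * s)"
      if f: "f \<in> V" and s: "s \<ge> 0" and fs: "\<forall>j<Suc m. cmod (f (X j)) \<le> s" for f s
    proof -
      obtain g where g: "g \<in> V" "\<forall>j<m. g (X j) = f (X j)" "\<forall>x\<in>D. cmod (g x) \<le> K * s"
        using K[OF f s] fs by auto
      have "g (X m) = f (X m)"
        using False g diff[OF g(1) f] by auto
      with g show ?thesis
        by (auto intro!: bexI[OF _ g(1)] simp: less_Suc_eq)
    qed
    with \<open>K \<ge> 0\<close> show ?thesis by blast
  next
    case True
    then obtain e' where e': "e' \<in> V" "\<forall>j<m. e' (X j) = 0" "e' (X m) \<noteq> 0" by blast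
    define e where "e = (\<lambda>x. inverse (e' (X m)) * e' x)"
    have e: "e \<in> V" "\<forall>j<m. e (X j) = 0" "e (X m) = 1"
      using e' scale unfolding e_def by auto
    obtain E where E: "\<forall>x\<in>D. cmod (e x) \<le> E"
      using bounded[OF e(1)] by blast
    then have "E \<ge> 0"
      using Xm norm_ge_zero order_trans by blast
    \<comment> \<open>The correction is c e, where c is the error of \<open>g\<close> at the new
      point: at most s from \<open>f\<close> plus K s from \<open>g\<close>.\<close>
    have "\<exists>g\<in>V. (\<forall>j<Suc m. g (X j) = f (X j)) \<and> (\<forall>x\<in>D. cmod (g x) \<le> (K + (1 + K) * E) * s)"
      if f: "f \<in> V" and s: "s \<ge> 0" and fs: "\<forall>j<Suc m. cmod (f (X j)) \<le> s" for f s
    proof -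
      obtain g where g: "g \<in> V" "\<forall>j<m. g (X j) = f (X j)" "\<forall>x\<in>D. cmod (g x) \<le> K * s"
        using K[OF f s] fs by auto
      define c where "c = f (X m) - g (X m)"
      have "cmod c \<le> cmod (f (X m)) + cmod (g (X m))"
        unfolding c_def by (rule norm_triangle_ineq4)
      also have "\<dots> \<le> s + K * s"
        using fs g(3) Xm by (intro add_mono) auto
      finally have c: "cmod c \<le> (1 + K) * s" by (simp add: algebra_simps)
      have "cmod (g x + c * e x) \<le> (K + (1 + K) * E) * s" if "x \<in> D" for x
      proof -
        have "cmod (g x + c * e x) \<le> cmod (g x) + cmod c * cmod (e x)"
          by (metis norm_mult norm_triangle_ineq)
        also have "\<dots> \<le> K * s + ((1 + K) * s) * E"
          using g(3) E c that \<open>K \<ge> 0\<close> s by (intro add_mono mult_mono) auto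
        finally show ?thesis by (simp add: algebra_simps)
      qed
      moreover have "(\<lambda>x. g x + c * e x) \<in> V"
        using add[OF g(1) scale[OF e(1)]] .
      ultimately show ?thesis
        using g(2) e by (intro bexI[of _ "\<lambda>x. g x + c * e x"]) (auto simp: less_Suc_eq c_def)
    qed
    moreover have "K + (1 + K) * E \<ge> 0"
      using \<open>K \<ge> 0\<close> \<open>E \<ge> 0\<close> by simp
    ultimately show ?thesis by blast
  qed
qed

text \<open>Separation in the quotient by the functions that vanish at the first \<open>m\<close> sample points.\<close>

definition separated :: "nat \<Rightarrow> (nat \<Rightarrow> 'a) \<Rightarrow> real \<Rightarrow> ('a \<Rightarrow> complex) set \<Rightarrow> bool" where
  "separated m X \<delta> F \<longleftrightarrow>
     (\<forall>f\<in>F. \<forall>g\<in>F. f \<noteq> g \<longrightarrow>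
       (\<forall>u\<in>V. \<forall>B. (\<forall>j<m. u (X j) = f (X j) - g (X j)) \<longrightarrow> (\<forall>x\<in>D. cmod (u x) \<le> B) \<longrightarrow> \<delta> \<le> B))"

lemma separatedD:
  assumes "separated m X \<delta> F" "f \<in> F" "g \<in> F" "f \<noteq> g" "u \<in> V"
    and "\<And>j. j < m \<Longrightarrow> u (X j) = f (X j) - g (X j)" "\<And>x. x \<in> D \<Longrightarrow> cmod (u x) \<le> B"
  shows "\<delta> \<le> B"
  using assms unfolding separated_def by blast

text \<open>Pigeonhole: rounding the real and imaginary parts of the \<open>m\<close> samples puts
  the functions into boxes, and separated functions cannot share a box. The two parts explain the
  exponent. \<open>K\<close> is chosen before \<open>F\<close> and \<delta>, so that the lemma can
  be applied to ever finer separations.\<close>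

lemma crude_packing_bound:
  fixes m :: nat
  assumes X: "X ` {..<m} \<subseteq> D" and "R > 0"
  shows "\<exists>K>0. \<forall>F \<delta>. F \<subseteq> V \<longrightarrow> (\<forall>f\<in>F. \<forall>x\<in>D. cmod (f x) \<le> R) \<longrightarrow> 0 < \<delta> \<longrightarrow> \<delta> \<le> R \<longrightarrow>
           separated m X \<delta> F \<longrightarrow> real (card F) \<le> (K / \<delta>) ^ (2 * m)"
proof -
  obtain K0 where "K0 \<ge> 0" and
    K0: "\<And>f s. f \<in> V \<Longrightarrow> s \<ge> 0 \<Longrightarrow> (\<forall>j<m. cmod (f (X j)) \<le> s) \<Longrightarrow>
           (\<exists>g\<in>V. (\<forall>j<m. g (X j) = f (X j)) \<and> (\<forall>x\<in>D. cmod (g x) \<le> K0 * s))"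
    using small_interpolant_ex[OF X] by blast
  define K where "K = K0 + 1"
  have "K > 0" using \<open>K0 \<ge> 0\<close> by (simp add: K_def)
  have "real (card F) \<le> ((8 * K * R + 3 * R) / \<delta>) ^ (2 * m)"
    if F: "F \<subseteq> V" and FR: "\<forall>f\<in>F. \<forall>x\<in>D. cmod (f x) \<le> R" and "0 < \<delta>" "\<delta> \<le> R"
      and sep: "separated m X \<delta> F" for F \<delta>
  proof -
    \<comment> \<open>Samples in a common box of side 1/s differ by at most 2/s, so the difference
      has a representative bounded by K * 2/s = \<delta>/2.\<close>
    define s where "s = 4 * K / \<delta>"
    have s: "s > 0" using \<open>K > 0\<close> \<open>0 < \<delta>\<close> by (simp add: s_def)
    define a where "a = \<lceil>s * R\<rceil>"
    have a: "a \<ge> 0" using mult_pos_pos[OF s \<open>R > 0\<close>] unfolding a_def by linarith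
    define cell where "cell = (\<lambda>f. \<lambda>j\<in>{..<m}. (\<lfloor>s * Re (f (X j))\<rfloor>, \<lfloor>s * Im (f (X j))\<rfloor>))"
    let ?P = "{..<m} \<rightarrow>\<^sub>E ({-a..a} \<times> {-a..a})"
    have fl: "\<lfloor>s * t\<rfloor> \<in> {-a..a}" if "\<bar>t\<bar> \<le> R" for t
    proof -
      have "s * t \<le> s * R" "s * (-R) \<le> s * t"
        using that s by (intro mult_left_mono; simp)+
      then show ?thesis unfolding a_def by simp linarith
    qed
    have "cell ` F \<subseteq> ?P"
    proof
      fix c assume "c \<in> cell ` F"
      then obtain f where f: "f \<in> F" and c: "c = cell f" by blast
      have "\<bar>Re (f (X j))\<bar> \<le> R" "\<bar>Im (f (X j))\<bar> \<le> R" if "j < m" for j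
        using FR f X that abs_Re_le_cmod abs_Im_le_cmod order_trans by blast+
      then show "c \<in> ?P"
        unfolding c cell_def using fl by (intro restrict_PiE_iff[THEN iffD2]) auto
    qed
    moreover have "inj_on cell F"
    proof (rule inj_onI, rule ccontr)
      fix f g assume f: "f \<in> F" and g: "g \<in> F" and eq: "cell f = cell g" and "f \<noteq> g"
      have close: "cmod (f (X j) - g (X j)) \<le> 2 / s" if "j < m" for j
      proof -
        have *: "\<bar>p - q\<bar> \<le> 1 / s" if "\<lfloor>s * p\<rfloor> = \<lfloor>s * q\<rfloor>" for p q :: real
        proof -
          have "\<bar>s * p - s * q\<bar> \<le> 1" using that by linarith
          then have "s * \<bar>p - q\<bar> \<le> 1"
            using s by (simp add: abs_mult flip: right_diff_distrib)
          then show ?thesis using s by (simp add: field_simps)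
        qed
        have "cell f j = cell g j" using eq by simp
        then have "\<bar>Re (f (X j) - g (X j))\<bar> \<le> 1 / s" "\<bar>Im (f (X j) - g (X j))\<bar> \<le> 1 / s"
          using that * by (auto simp: cell_def)
        then show ?thesis
          using cmod_le[of "f (X j) - g (X j)"] by simp
      qed
      have fg: "(\<lambda>x. f x - g x) \<in> V" using diff f g F by blast
      obtain u where u: "u \<in> V" "\<forall>j<m. u (X j) = f (X j) - g (X j)"
        "\<forall>x\<in>D. cmod (u x) \<le> K0 * (2 / s)"
        using K0[OF fg, of "2 / s"] close s by auto
      have "\<delta> \<le> K0 * (2 / s)"
        using separatedD[OF sep f g \<open>f \<noteq> g\<close> u(1)] u(2,3) by blast
      also have "\<dots> \<le> K * (2 / s)" using s by (intro mult_right_mono) (auto simp: K_def)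
      also have "\<dots> = \<delta> / 2" using \<open>K > 0\<close> \<open>0 < \<delta>\<close> by (simp add: s_def)
      finally show False using \<open>0 < \<delta>\<close> by simp
    qed
    ultimately have "card F \<le> card ?P"
      by (metis card_image card_mono finite_PiE finite_SigmaI finite_atLeastAtMost_int finite_lessThan)
    also have "card ?P = (nat (2 * a + 1) ^ 2) ^ m"
      using a by (simp add: card_PiE power2_eq_square algebra_simps)
    finally have "card F \<le> nat (2 * a + 1) ^ (2 * m)"
      by (simp add: power_mult)
    then have "real (card F) \<le> real (nat (2 * a + 1)) ^ (2 * m)"
      by (metis of_nat_le_iff of_nat_power)
    also have "\<dots> \<le> ((8 * K * R + 3 * R) / \<delta>) ^ (2 * m)"
    proof (rule power_mono)
      have "real (nat (2 * a + 1)) = 2 * real_of_int a + 1" using a by simp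
      also have "\<dots> \<le> 2 * (s * R + 1) + 1"
        unfolding a_def by (intro add_mono mult_left_mono of_int_ceiling_le_add_one) auto
      \<comment> \<open>By \<delta> \<le> R, the additive constant is a multiple of 1/\<delta> as
        well.\<close>
      also have "\<dots> \<le> 2 * (s * R) + 3 * (R / \<delta>)"
        using \<open>0 < \<delta>\<close> \<open>\<delta> \<le> R\<close> by (simp add: field_simps)
      finally show "real (nat (2 * a + 1)) \<le> (8 * K * R + 3 * R) / \<delta>"
        by (simp add: s_def add_divide_distrib)
    qed simp
    finally show ?thesis .
  qed
  moreover have "8 * K * R + 3 * R > 0" using \<open>K > 0\<close> \<open>R > 0\<close> by (simp add: add_pos_pos)
  ultimately show ?thesis by blast
qed

text \<open>Instead of comparing volumes, the proof applies the crude bound to the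
  iterated Minkowski sums \<open>F + q F + \<dots> + q\<^sup>s\<^sup>-\<^sup>1 F\<close>, whose cardinality is \<open>card F ^ s\<close>:
  the unknown constant of the crude bound disappears as \<open>s\<close> tends to infinity.\<close>

lemma packing_bound:
  fixes m :: nat
  assumes X: "X ` {..<m} \<subseteq> D" and "F \<subseteq> V" and FR: "\<And>f x. f \<in> F \<Longrightarrow> x \<in> D \<Longrightarrow> cmod (f x) \<le> R"
    and "0 < \<delta>" "\<delta> \<le> R" and sep: "separated m X \<delta> F"
  shows "real (card F) \<le> (8 * R / \<delta>) ^ (2 * m)"
proof -
  have "R > 0" using assms by linarith
  \<comment> \<open>The tails of two sums differ by at most 4 R q = \<delta>/2, which hides only
    half of the separation of the leading terms, and q \<le> 1/2 keeps all sums within radius 2 R.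
    The base 8 R / \<delta> of the result is 1/q.\<close>
  define q where "q = \<delta> / (8 * R)"
  have q: "0 < q" "q \<le> 1 / 2" and Rq: "4 * R * q = \<delta> / 2"
    using \<open>0 < \<delta>\<close> \<open>\<delta> \<le> R\<close> \<open>R > 0\<close> by (auto simp: q_def field_simps)
  have sums: "\<exists>G \<subseteq> V. card G = card F ^ s \<and> (\<forall>g\<in>G. \<forall>x\<in>D. cmod (g x) \<le> 2 * R) \<and>
               separated m X (q ^ s * (\<delta> / 2)) G" for s
  proof (induction s)
    case 0
    show ?case
      using zero \<open>R > 0\<close> by (intro exI[of _ "{\<lambda>_. 0}"]) (auto simp: separated_def)
  next
    case (Suc s)
    then obtain G where G: "G \<subseteq> V" "card G = card F ^ s"
      and GR: "\<And>g x. g \<in> G \<Longrightarrow> x \<in> D \<Longrightarrow> cmod (g x) \<le> 2 * R"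
      and Gsep: "separated m X (q ^ s * (\<delta> / 2)) G"
      by blast
    define \<phi> where "\<phi> = (\<lambda>(f :: 'a \<Rightarrow> complex, g :: 'a \<Rightarrow> complex) x. f x + of_real q * g x)"
    have key: "q ^ Suc s * (\<delta> / 2) \<le> B"
      if f: "f \<in> F" "f' \<in> F" and g: "g \<in> G" "g' \<in> G" and ne: "(f, g) \<noteq> (f', g')" and u: "u \<in> V"
        and uX: "\<And>j. j < m \<Longrightarrow> u (X j) = \<phi> (f, g) (X j) - \<phi> (f', g') (X j)"
        and uB: "\<And>x. x \<in> D \<Longrightarrow> cmod (u x) \<le> B" for f f' g g' u B
    proof (cases "f = f'")
      case True
      \<comment> \<open>Equal leading terms: u/q represents the difference of the tails.\<close>
      have "q ^ s * (\<delta> / 2) \<le> B / q"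
      proof (rule separatedD[OF Gsep g])
        show "g \<noteq> g'" using ne True by simp
        show "(\<lambda>x. of_real (1 / q) * u x) \<in> V" using scale u by blast
        show "of_real (1 / q) * u (X j) = g (X j) - g' (X j)" if "j < m" for j
          using uX[OF that] True q by (simp add: \<phi>_def field_simps)
        show "cmod (of_real (1 / q) * u x) \<le> B / q" if "x \<in> D" for x
          using uB[OF that] q by (simp add: norm_divide divide_right_mono)
      qed
      then show ?thesis using q by (simp add: field_simps)
    next
      case False
      \<comment> \<open>Different leading terms: removing the tails from \<open>u\<close> leaves a
        representative of f - f'.\<close>
      have "\<delta> \<le> B + q * (2 * R + 2 * R)"
      proof (rule separatedD[OF sep f False])
        show "(\<lambda>x. u x - of_real q * (g x - g' x)) \<in> V"
          using g G(1) u by (intro diff scale) auto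
        show "u (X j) - of_real q * (g (X j) - g' (X j)) = f (X j) - f' (X j)" if "j < m" for j
          using uX[OF that] by (simp add: \<phi>_def algebra_simps)
        fix x assume x: "x \<in> D"
        have "cmod (u x - of_real q * (g x - g' x)) \<le> cmod (u x) + cmod (of_real q * (g x - g' x))"
          by (rule norm_triangle_ineq4)
        also have "cmod (of_real q * (g x - g' x)) = q * cmod (g x - g' x)"
          using q by (simp add: norm_mult)
        also have "cmod (g x - g' x) \<le> cmod (g x) + cmod (g' x)"
          by (rule norm_triangle_ineq4)
        finally show "cmod (u x - of_real q * (g x - g' x)) \<le> B + q * (2 * R + 2 * R)"
          using uB[OF x] GR[OF g(1) x] GR[OF g(2) x] q
          by (smt (verit) mult_left_mono)
      qed
      then have "\<delta> / 2 \<le> B" using Rq by (simp add: algebra_simps)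
      moreover have "q ^ Suc s \<le> 1" using q by (intro power_le_one) auto
      then have "q ^ Suc s * (\<delta> / 2) \<le> 1 * (\<delta> / 2)"
        using \<open>0 < \<delta>\<close> by (intro mult_right_mono) auto
      ultimately show ?thesis by linarith
    qed
    have inj: "inj_on \<phi> (F \<times> G)"
    proof (rule inj_onI, rule ccontr)
      fix p p' assume pp: "p \<in> F \<times> G" "p' \<in> F \<times> G" "\<phi> p = \<phi> p'" "p \<noteq> p'"
      \<comment> \<open>If two sums coincided, 0 would represent their difference.\<close>
      have "q ^ Suc s * (\<delta> / 2) \<le> 0"
        using pp by (intro key[of "fst p" "fst p'" "snd p" "snd p'" "\<lambda>_. 0"]) (auto simp: zero)
      then show False
        using zero_less_power[OF q(1), of "Suc s"] \<open>0 < \<delta>\<close> by (simp add: mult_le_0_iff del: power_Suc)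
    qed
    have "\<phi> p \<in> V" if "p \<in> F \<times> G" for p
      using that G(1) \<open>F \<subseteq> V\<close> by (auto simp: \<phi>_def intro!: add scale)
    moreover have "card (\<phi> ` (F \<times> G)) = card F ^ Suc s"
      using inj G(2) by (simp add: card_image card_cartesian_product)
    moreover have "cmod (\<phi> p x) \<le> 2 * R" if "p \<in> F \<times> G" "x \<in> D" for p x
    proof -
      obtain f g where p: "p = (f, g)" "f \<in> F" "g \<in> G" using \<open>p \<in> F \<times> G\<close> by blast
      have "cmod (\<phi> p x) \<le> cmod (f x) + cmod (of_real q * g x)"
        unfolding p \<phi>_def by (simp add: norm_triangle_ineq)
      also have "\<dots> \<le> R + 1 / 2 * (2 * R)"
        unfolding norm_mult using FR GR p that q by (intro add_mono mult_mono) auto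
      finally show ?thesis by simp
    qed
    moreover have "separated m X (q ^ Suc s * (\<delta> / 2)) (\<phi> ` (F \<times> G))"
      unfolding separated_def
    proof (intro ballI allI impI)
      fix h h' u B
      assume h: "h \<in> \<phi> ` (F \<times> G)" "h' \<in> \<phi> ` (F \<times> G)" "h \<noteq> h'" and "u \<in> V"
        and "\<forall>j<m. u (X j) = h (X j) - h' (X j)" "\<forall>x\<in>D. cmod (u x) \<le> B"
      moreover obtain f g f' g' where "h = \<phi> (f, g)" "h' = \<phi> (f', g')"
        "f \<in> F" "g \<in> G" "f' \<in> F" "g' \<in> G"
        using h(1,2) by blast
      ultimately show "q ^ Suc s * (\<delta> / 2) \<le> B"
        by (intro key[of f f' g g' u B]) auto
    qed
    ultimately show ?case
      by (intro exI[of _ "\<phi> ` (F \<times> G)"]) blast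
  qed
  obtain K where "K > 0" and
    K: "\<And>F \<delta>. F \<subseteq> V \<Longrightarrow> (\<forall>f\<in>F. \<forall>x\<in>D. cmod (f x) \<le> 2 * R) \<Longrightarrow> 0 < \<delta> \<Longrightarrow> \<delta> \<le> 2 * R \<Longrightarrow>
           separated m X \<delta> F \<Longrightarrow> real (card F) \<le> (K / \<delta>) ^ (2 * m)"
    using crude_packing_bound[OF X, of "2 * R"] \<open>R > 0\<close> by auto
  show ?thesis
  proof (rule bound_of_power_bound)
    show "(8 * R / \<delta>) ^ (2 * m) > 0" using \<open>R > 0\<close> \<open>0 < \<delta>\<close> by simp
    fix s
    obtain G where G: "G \<subseteq> V" "card G = card F ^ s" "\<forall>g\<in>G. \<forall>x\<in>D. cmod (g x) \<le> 2 * R"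
      "separated m X (q ^ s * (\<delta> / 2)) G"
      using sums by blast
    have "q ^ s \<le> 1" using q by (intro power_le_one) auto
    then have "q ^ s * (\<delta> / 2) \<le> 1 * (\<delta> / 2)"
      using \<open>0 < \<delta>\<close> by (intro mult_right_mono) auto
    then have "q ^ s * (\<delta> / 2) \<le> 2 * R"
      using \<open>0 < \<delta>\<close> \<open>\<delta> \<le> R\<close> by linarith
    then have "real (card G) \<le> (K / (q ^ s * (\<delta> / 2))) ^ (2 * m)"
      using zero_less_power[OF q(1), of s] \<open>0 < \<delta>\<close> \<open>\<delta> \<le> R\<close> by (intro K G(1,3,4)) auto
    also have "K / (q ^ s * (\<delta> / 2)) = (2 * K / \<delta>) * (8 * R / \<delta>) ^ s"
      (is "_ = ?c * _")
      using \<open>R > 0\<close> \<open>0 < \<delta>\<close> by (simp add: q_def field_simps)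
    also have "(?c * (8 * R / \<delta>) ^ s) ^ (2 * m) = ?c ^ (2 * m) * ((8 * R / \<delta>) ^ s) ^ (2 * m)"
      by (rule power_mult_distrib)
    also have "((8 * R / \<delta>) ^ s) ^ (2 * m) = ((8 * R / \<delta>) ^ (2 * m)) ^ s"
      by (simp add: mult.commute flip: power_mult)
    finally show "real (card F) ^ s \<le> (2 * K / \<delta>) ^ (2 * m) * ((8 * R / \<delta>) ^ (2 * m)) ^ s"
      unfolding G(2) of_nat_power .
  qed
qed

end

subsection \<open>Almost disjoint families and signs\<close>

text \<open>Factor by factor, N/n \<le> (N - i)/(n - i) for i < h.\<close>

lemma binomial_ratio_ge:
  assumes "h \<le> n" "n \<le> N" "n \<ge> 1"
  shows "(real N / real n) ^ h * real (n choose h) \<le> real (N choose h)"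
proof -
  have "(real N / real n) ^ h * real (n choose h) =
          (\<Prod>i=0..<h. real N / real n * (real (n - i) / real (h - i)))"
    unfolding prod.distrib binomial_altdef_of_nat[OF assms(1)] prod_constant by simp
  also have "\<dots> \<le> (\<Prod>i=0..<h. real (N - i) / real (h - i))"
  proof (intro prod_mono conjI)
    fix i assume "i \<in> {0..<h}"
    then have i: "i < h" "i < n" "i < N" using assms(1,2) by auto
    have "real N * real (n - i) \<le> real n * real (N - i)"
      using i assms mult_left_mono[of "real n" "real N" "real i"]
      by (simp add: of_nat_diff algebra_simps)
    then have "real N / real n * real (n - i) \<le> real (N - i)"
      using assms by (simp add: field_simps)
    then show "real N / real n * (real (n - i) / real (h - i)) \<le> real (N - i) / real (h - i)"
      using divide_right_mono[of "real N / real n * real (n - i)" "real (N - i)" "real (h - i)"]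
      by simp
  qed simp
  also have "\<dots> = real (N choose h)"
    using assms by (intro binomial_altdef_of_nat[symmetric]) auto
  finally show ?thesis .
qed

text \<open>Greedy (Gilbert--Varshamov) choice: an \<open>n\<close>-subset that cannot be added to a maximal family
  shares more than \<open>n/2\<close> elements with a member of it.\<close>

lemma almost_disjoint_family_ex:
  assumes Q: "finite Q" and n: "1 \<le> n" "n \<le> card Q"
  shows "\<exists>\<F>. (\<forall>I\<in>\<F>. I \<subseteq> Q \<and> card I = n) \<and>
           (\<forall>I\<in>\<F>. \<forall>J\<in>\<F>. I \<noteq> J \<longrightarrow> 2 * card (I \<inter> J) \<le> n) \<and>
           (real (card Q) / (4 * real n)) powr (real n / 2) \<le> real (card \<F>)"
proof -
  define N where "N = card Q"
  define \<S> where "\<S> = {I. I \<subseteq> Q \<and> card I = n}"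
  have fin: "finite \<S>" unfolding \<S>_def using Q by simp
  define fams where
    "fams = {\<F>. \<F> \<subseteq> \<S> \<and> (\<forall>I\<in>\<F>. \<forall>J\<in>\<F>. I \<noteq> J \<longrightarrow> 2 * card (I \<inter> J) \<le> n)}"
  have "finite fams" "{} \<in> fams"
    using fin by (auto simp: fams_def)
  then obtain \<F> where \<F>: "\<F> \<in> fams" and max: "\<And>\<G>. \<G> \<in> fams \<Longrightarrow> \<F> \<subseteq> \<G> \<Longrightarrow> \<F> = \<G>"
    using finite_has_maximal[of fams] by blast
  have \<F>\<S>: "\<F> \<subseteq> \<S>" and finF: "finite \<F>"
    using \<F> finite_subset[OF _ fin] by (auto simp: fams_def)
  \<comment> \<open>The least forbidden size of an intersection.\<close>
  define h where "h = n div 2 + 1"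
  have h: "h \<le> n" "h \<ge> 1" "real n / 2 \<le> real h" using n by (auto simp: h_def)
  define ext where "ext = (\<lambda>A. {J. A \<subseteq> J \<and> J \<in> \<S>})"
  \<comment> \<open>Members of the family are covered too, since they meet themselves in n \<ge> h
    elements. Counting all n-subsets by the h-subset of a member that they contain bounds the family
    from below.\<close>
  have "\<S> \<subseteq> (\<Union>I\<in>\<F>. \<Union>A\<in>{A. A \<subseteq> I \<and> card A = h}. ext A)"
  proof
    fix J assume J: "J \<in> \<S>"
    have "\<exists>I\<in>\<F>. h \<le> card (I \<inter> J)"
    proof (rule ccontr)
      assume "\<not> ?thesis"
      then have less: "card (I \<inter> J) < h" if "I \<in> \<F>" for I using that by force
      then have "J \<notin> \<F>" using J h by (force simp: \<S>_def)
      moreover have "2 * card (I \<inter> J) \<le> n" "2 * card (J \<inter> I) \<le> n" if "I \<in> \<F>" for I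
        using less[OF that] by (auto simp: h_def Int_commute)
      then have "insert J \<F> \<in> fams" using \<F> J by (auto simp: fams_def)
      ultimately show False using max[of "insert J \<F>"] by blast
    qed
    then obtain I where I: "I \<in> \<F>" "h \<le> card (I \<inter> J)" by blast
    obtain A where "A \<subseteq> I \<inter> J" "card A = h"
      using obtain_subset_with_card_n[OF I(2)] by blast
    with I J show "J \<in> (\<Union>I\<in>\<F>. \<Union>A\<in>{A. A \<subseteq> I \<and> card A = h}. ext A)"
      unfolding ext_def by blast
  qed
  moreover have finU: "finite (\<Union>I\<in>\<F>. \<Union>A\<in>{A. A \<subseteq> I \<and> card A = h}. ext A)"
    by (rule finite_subset[OF _ fin]) (auto simp: ext_def)
  ultimately have "card \<S> \<le> card (\<Union>I\<in>\<F>. \<Union>A\<in>{A. A \<subseteq> I \<and> card A = h}. ext A)"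
    by (rule card_mono[rotated])
  also have "\<dots> \<le> (\<Sum>I\<in>\<F>. card (\<Union>A\<in>{A. A \<subseteq> I \<and> card A = h}. ext A))"
    by (rule card_UN_le[OF finF])
  also have "\<dots> \<le> (\<Sum>I\<in>\<F>. (n choose h) * ((N - h) choose (n - h)))"
  proof (rule sum_mono)
    fix I assume "I \<in> \<F>"
    then have I: "I \<subseteq> Q" "card I = n" "finite I"
      using \<F>\<S> Q rev_finite_subset[OF Q] by (auto simp: \<S>_def)
    have "card (ext A) \<le> (N - h) choose (n - h)" if A: "A \<subseteq> I" "card A = h" for A
    proof -
      have finA: "finite A" "A \<subseteq> Q" using A I by (auto intro: finite_subset)
      have "inj_on (\<lambda>J. J - A) (ext A)" by (rule inj_onI) (auto simp: ext_def)
      moreover have "(\<lambda>J. J - A) ` ext A \<subseteq> {B. B \<subseteq> Q - A \<and> card B = n - h}"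
        using A finA by (auto simp: ext_def \<S>_def card_Diff_subset)
      ultimately have "card (ext A) \<le> card {B. B \<subseteq> Q - A \<and> card B = n - h}"
        using Q by (intro card_inj_on_le[of "\<lambda>J. J - A"]) auto
      also have "\<dots> = (N - h) choose (n - h)"
        using Q finA A by (simp add: n_subsets card_Diff_subset N_def)
      finally show ?thesis .
    qed
    then have "(\<Sum>A | A \<subseteq> I \<and> card A = h. card (ext A)) \<le>
                 (\<Sum>A | A \<subseteq> I \<and> card A = h. (N - h) choose (n - h))"
      by (intro sum_mono) auto
    also have "\<dots> = (n choose h) * ((N - h) choose (n - h))"
      using I by (simp add: n_subsets)
    finally show "card (\<Union>A\<in>{A. A \<subseteq> I \<and> card A = h}. ext A) \<le>
                   (n choose h) * ((N - h) choose (n - h))"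
      using card_UN_le[of "{A. A \<subseteq> I \<and> card A = h}" ext] I by simp
  qed
  finally have "N choose n \<le> card \<F> * ((n choose h) * ((N - h) choose (n - h)))"
    using Q by (simp add: \<S>_def n_subsets N_def)
  \<comment> \<open>The extra factor turns the left side into (N choose h) * ((N - h) choose (n -
    h)), whose second factor cancels.\<close>
  then have "(N choose n) * (n choose h) \<le>
               card \<F> * ((n choose h) * ((N - h) choose (n - h))) * (n choose h)"
    by (rule mult_right_mono) simp
  also have "\<dots> = card \<F> * (n choose h) * (n choose h) * ((N - h) choose (n - h))"
    by (simp only: mult_ac)
  finally have "(N choose h) * ((N - h) choose (n - h)) \<le>
               card \<F> * (n choose h) * (n choose h) * ((N - h) choose (n - h))"
    by (subst (asm) choose_mult) (use h n in \<open>auto simp: N_def\<close>)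
  moreover have "(N - h) choose (n - h) > 0" using n h by (simp add: N_def diff_le_mono)
  ultimately have "N choose h \<le> card \<F> * (n choose h) * (n choose h)" by simp
  then have "real (N choose h) \<le> real (card \<F>) * real (n choose h) * real (n choose h)"
    by (metis of_nat_le_iff of_nat_mult)
  with binomial_ratio_ge[OF h(1) n(2,1)]
  have "(real N / real n) ^ h * real (n choose h) \<le>
          real (card \<F>) * real (n choose h) * real (n choose h)"
    by (simp add: N_def)
  moreover have "real (n choose h) > 0" using h by simp
  ultimately have "(real N / real n) ^ h \<le> real (card \<F>) * real (n choose h)" by simp
  \<comment> \<open>One factor n choose h was absorbed by \<open>binomial_ratio_ge\<close>; the
    other one costs 2^n = 4^(n/2), hence the 4n in the base.\<close>
  also have "n choose h \<le> 2 ^ n"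
    by (rule binomial_le_pow2)
  then have "real (card \<F>) * real (n choose h) \<le> real (card \<F>) * 2 ^ n"
    by (intro mult_left_mono) (simp_all add: numeral_power_le_of_nat_cancel_iff)
  finally have *: "(real N / real n) ^ h \<le> real (card \<F>) * 2 ^ n" .
  have ge1: "real N / real n \<ge> 1" using n by (simp add: N_def)
  have "(real N / (4 * real n)) powr (real n / 2) =
          (real N / real n) powr (real n / 2) / 4 powr (real n / 2)"
    (is "_ = _ / ?p")
    using n powr_divide[of "real N / real n" 4 "real n / 2"] by (simp add: mult.commute)
  also have "?p = 2 ^ n"
  proof -
    have "(4::real) powr (real n / 2) = (2 powr 2) powr (real n / 2)" by simp
    also have "\<dots> = 2 ^ n" unfolding powr_powr by (simp add: powr_realpow)
    finally show ?thesis .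
  qed
  also have "(real N / real n) powr (real n / 2) \<le> (real N / real n) powr (real h)"
    using ge1 h(3) by (rule powr_mono[rotated])
  also have "\<dots> = (real N / real n) ^ h" using ge1 by (intro powr_realpow) auto
  also note *
  finally have "(real N / (4 * real n)) powr (real n / 2) \<le> real (card \<F>)"
    by (simp add: divide_right_mono)
  moreover have "\<forall>I\<in>\<F>. I \<subseteq> Q \<and> card I = n"
    using \<F>\<S> by (auto simp: \<S>_def)
  moreover have "\<forall>I\<in>\<F>. \<forall>J\<in>\<F>. I \<noteq> J \<longrightarrow> 2 * card (I \<inter> J) \<le> n"
    using \<F> by (simp add: fams_def)
  ultimately show ?thesis
    unfolding N_def by (intro exI[of _ \<F>] conjI)
qed

section \<open>Signs with small sums at finitely many points\<close>

text \<open>The moment generating function of a fair sign: this is the inequality behind Hoeffding's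
  lemma for success probability 1/2 and an interval of length 2, extended to negative arguments by
  evenness.\<close>

lemma cosh_le_exp_half_square: "cosh (x::real) \<le> exp (x\<^sup>2 / 2)"
proof -
  have nonneg: "cosh y \<le> exp (y\<^sup>2 / 2)" if "y \<ge> 0" for y :: real
  proof -
    have "- (2 * y) * (1 / 2) + ln (1 + 1 / 2 * (exp (2 * y) - 1)) \<le> (2 * y)\<^sup>2 / 8"
      using that by (intro Hoeffdings_lemma_aux) auto
    moreover have "1 + 1 / 2 * (exp (2 * y) - 1) = exp y * cosh y"
    proof -
      have "exp y * exp y = exp (2 * y)" "exp y * exp (- y) = 1"
        by (simp_all flip: exp_add)
      then show ?thesis by (simp add: cosh_field_def field_simps)
    qed
    ultimately have "ln (cosh y) \<le> y\<^sup>2 / 2"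
      by (simp add: ln_mult power2_eq_square)
    then show ?thesis by (metis cosh_real_pos exp_le_cancel_iff exp_ln)
  qed
  show ?thesis using nonneg[of "\<bar>x\<bar>"] by (simp add: cosh_real_abs)
qed

text \<open>The method of conditional expectations: of the two values of \<open>cosh\<close> for the two choices of
  a sign, the average is \<open>cosh s * cosh a\<close>.\<close>

lemma cosh_potential_signs_ex:
  fixes a :: "'k \<Rightarrow> 'p \<Rightarrow> real" and t :: real
  assumes "finite I" and "\<And>k p. k \<in> I \<Longrightarrow> p \<in> P \<Longrightarrow> \<bar>a k p\<bar> \<le> 1"
  shows "\<exists>\<epsilon>. (\<forall>k. \<epsilon> k \<in> {-1, 1}) \<and>
           (\<Sum>p\<in>P. cosh (t * (\<Sum>k\<in>I. \<epsilon> k * a k p))) \<le> real (card P) * exp (real (card I) * t\<^sup>2 / 2)"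
  using assms
proof (induction I rule: finite_induct)
  case empty
  show ?case by (intro exI[of _ "\<lambda>_. 1"]) simp
next
  case (insert k I)
  then obtain \<epsilon> where \<epsilon>: "\<forall>k. \<epsilon> k \<in> {-1, 1::real}" and
    le: "(\<Sum>p\<in>P. cosh (t * (\<Sum>k\<in>I. \<epsilon> k * a k p))) \<le> real (card P) * exp (real (card I) * t\<^sup>2 / 2)"
    using insert.IH insert.prems by blast
  define S where "S = (\<lambda>p. t * (\<Sum>k\<in>I. \<epsilon> k * a k p))"
  define \<Phi> where "\<Phi> = (\<lambda>\<sigma>. \<Sum>p\<in>P. cosh (S p + \<sigma> * (t * a k p)))"
  have "\<Phi> 1 + \<Phi> (-1) = 2 * (\<Sum>p\<in>P. cosh (S p) * cosh (t * a k p))"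
    unfolding \<Phi>_def sum.distrib[symmetric] sum_distrib_left
    by (intro sum.cong) (simp_all add: cosh_add cosh_diff)
  also have "\<dots> \<le> 2 * (\<Sum>p\<in>P. cosh (S p) * exp (t\<^sup>2 / 2))"
  proof (intro mult_left_mono sum_mono)
    fix p assume p: "p \<in> P"
    have "\<bar>a k p\<bar>\<^sup>2 \<le> 1\<^sup>2"
      using insert.prems p by (intro power_mono) auto
    then have "(t * a k p)\<^sup>2 \<le> t\<^sup>2"
      by (simp add: power_mult_distrib mult_left_le)
    then show "cosh (t * a k p) \<le> exp (t\<^sup>2 / 2)"
      using cosh_le_exp_half_square[of "t * a k p"] by (smt (verit) divide_right_mono exp_le_cancel_iff)
  qed auto
  also have "\<dots> \<le> 2 * (real (card P) * exp (real (card I) * t\<^sup>2 / 2) * exp (t\<^sup>2 / 2))"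
    using le by (simp add: S_def flip: sum_distrib_right)
  also have "\<dots> = 2 * (real (card P) * exp (real (card (insert k I)) * t\<^sup>2 / 2))"
    using insert.hyps by (simp add: distrib_right add_divide_distrib exp_add)
  finally have "\<exists>\<sigma>\<in>{-1, 1}. \<Phi> \<sigma> \<le> real (card P) * exp (real (card (insert k I)) * t\<^sup>2 / 2)"
    by (smt (verit) insertCI)
  then obtain \<sigma> where \<sigma>: "\<sigma> \<in> {-1, 1}"
    "\<Phi> \<sigma> \<le> real (card P) * exp (real (card (insert k I)) * t\<^sup>2 / 2)" by blast
  have "t * (\<Sum>j\<in>insert k I. (\<epsilon>(k := \<sigma>)) j * a j p) = S p + \<sigma> * (t * a k p)" for p
  proof -
    have "(\<Sum>j\<in>I. (\<epsilon>(k := \<sigma>)) j * a j p) = (\<Sum>j\<in>I. \<epsilon> j * a j p)"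
      using insert.hyps by (intro sum.cong) auto
    then show ?thesis using insert.hyps by (simp add: S_def algebra_simps)
  qed
  with \<sigma> \<epsilon> show ?case
    by (intro exI[of _ "\<epsilon>(k := \<sigma>)"]) (simp add: \<Phi>_def)
qed

text \<open>Since exp |s| \<le> 2 cosh s and all terms of the potential are positive, a bound on the
  potential controls all points at once and replaces a union bound.\<close>

lemma signs_real_ex:
  fixes a :: "'k \<Rightarrow> 'p \<Rightarrow> real"
  assumes I: "finite I" "I \<noteq> {}" and P: "finite P" "P \<noteq> {}"
    and a: "\<And>k p. k \<in> I \<Longrightarrow> p \<in> P \<Longrightarrow> \<bar>a k p\<bar> \<le> 1"
  shows "\<exists>\<epsilon>. (\<forall>k. \<epsilon> k \<in> {-1, 1}) \<and>
           (\<forall>p\<in>P. \<bar>\<Sum>k\<in>I. \<epsilon> k * a k p\<bar> \<le> sqrt (2 * real (card I) * ln (2 * real (card P))))"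
proof -
  define n where "n = real (card I)"
  define H where "H = ln (2 * real (card P))"
  have cP: "real (card P) \<ge> 1" using P by (simp add: Suc_le_eq card_gt_0_iff)
  have n: "n > 0" and H: "H > 0"
    using I cP by (auto simp: n_def H_def card_gt_0_iff intro!: ln_gt_zero)
  \<comment> \<open>The minimiser of (H + n t^2 / 2) / t, at which both summands equal
    \<open>H\<close>.\<close>
  define t where "t = sqrt (2 * H / n)"
  have t: "t > 0" and t2: "t\<^sup>2 = 2 * H / n" using n H by (auto simp: t_def)
  obtain \<epsilon> where \<epsilon>: "\<forall>k. \<epsilon> k \<in> {-1, 1::real}" and
    le: "(\<Sum>p\<in>P. cosh (t * (\<Sum>k\<in>I. \<epsilon> k * a k p))) \<le> real (card P) * exp (n * t\<^sup>2 / 2)"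
    using cosh_potential_signs_ex[OF I(1), of P a t] a unfolding n_def by blast
  have "\<bar>\<Sum>k\<in>I. \<epsilon> k * a k p\<bar> \<le> sqrt (2 * n * H)" if p: "p \<in> P" for p
  proof -
    define s where "s = t * (\<Sum>k\<in>I. \<epsilon> k * a k p)"
    have "exp \<bar>s\<bar> \<le> 2 * cosh s"
      by (cases "s \<ge> 0") (simp_all add: cosh_field_def)
    also have "cosh s \<le> (\<Sum>p\<in>P. cosh (t * (\<Sum>k\<in>I. \<epsilon> k * a k p)))"
      unfolding s_def using P p by (intro member_le_sum) auto
    also note le
    also have "2 * (real (card P) * exp (n * t\<^sup>2 / 2)) = exp (H + H)"
      using n cP unfolding exp_add t2 by (simp add: H_def)
    finally have "t * \<bar>\<Sum>k\<in>I. \<epsilon> k * a k p\<bar> \<le> 2 * H"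
      using t by (simp add: s_def abs_mult)
    also have "2 * H = t * sqrt (2 * n * H)"
    proof -
      have "t * sqrt (2 * n * H) = sqrt ((2 * H)\<^sup>2)"
        unfolding t_def using n by (simp add: power2_eq_square flip: real_sqrt_mult)
      then show ?thesis using H by (simp only: real_sqrt_abs)
    qed
    finally show ?thesis using t by simp
  qed
  with \<epsilon> show ?thesis
    unfolding n_def H_def by (intro exI[of _ \<epsilon>] conjI ballI)
qed

text \<open>Real and imaginary parts count as separate points, which doubles the 2 inside the
  logarithm; recombining them costs a factor sqrt 2.\<close>

lemma signs_complex_ex:
  fixes a :: "'k \<Rightarrow> 'p \<Rightarrow> complex"
  assumes I: "finite I" "I \<noteq> {}" and P: "finite P" "P \<noteq> {}"
    and a: "\<And>k p. k \<in> I \<Longrightarrow> p \<in> P \<Longrightarrow> cmod (a k p) \<le> 1"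
  shows "\<exists>\<epsilon>. (\<forall>k. \<epsilon> k \<in> {-1, 1}) \<and>
           (\<forall>p\<in>P. cmod (\<Sum>k\<in>I. of_real (\<epsilon> k) * a k p) \<le>
              2 * sqrt (real (card I) * ln (4 * real (card P))))"
proof -
  define b where "b = (\<lambda>k (p, r). if r then Re (a k p) else Im (a k p))"
  have "\<bar>b k p\<bar> \<le> 1" if "k \<in> I" "p \<in> P \<times> (UNIV :: bool set)" for k p
  proof -
    obtain q r where p: "p = (q, r)" by force
    with a[of k q] that abs_Re_le_cmod[of "a k q"] abs_Im_le_cmod[of "a k q"] show ?thesis
      by (auto simp: b_def)
  qed
  moreover have "finite (P \<times> (UNIV :: bool set))" "P \<times> (UNIV :: bool set) \<noteq> {}"
    using P by auto
  ultimately obtain \<epsilon> where \<epsilon>: "\<forall>k. \<epsilon> k \<in> {-1, 1::real}" and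
    le: "\<And>p. p \<in> P \<times> UNIV \<Longrightarrow> \<bar>\<Sum>k\<in>I. \<epsilon> k * b k p\<bar> \<le>
           sqrt (2 * real (card I) * ln (2 * real (card (P \<times> (UNIV :: bool set)))))"
    using signs_real_ex[OF I, of "P \<times> UNIV" b] by blast
  have "cmod (\<Sum>k\<in>I. of_real (\<epsilon> k) * a k p) \<le> 2 * sqrt (real (card I) * ln (4 * real (card P)))"
    if p: "p \<in> P" for p
  proof -
    define z where "z = (\<Sum>k\<in>I. of_real (\<epsilon> k) * a k p)"
    define r where "r = 2 * real (card I) * ln (4 * real (card P))"
    have "real (card P) \<ge> 1" using P by (simp add: Suc_le_eq card_gt_0_iff)
    then have r: "r \<ge> 0" unfolding r_def by (intro mult_nonneg_nonneg ln_ge_zero) auto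
    have "\<bar>Re z\<bar> \<le> sqrt r" "\<bar>Im z\<bar> \<le> sqrt r"
      using le[of "(p, True)"] le[of "(p, False)"] p
      by (simp_all add: z_def b_def r_def card_cartesian_product mult_ac)
    then have "(Re z)\<^sup>2 \<le> r" "(Im z)\<^sup>2 \<le> r"
      using r power_mono[of "\<bar>Re z\<bar>" "sqrt r" 2] power_mono[of "\<bar>Im z\<bar>" "sqrt r" 2] by simp_all
    then have "cmod z \<le> sqrt (4 * (real (card I) * ln (4 * real (card P))))"
      unfolding cmod_def by (intro real_sqrt_le_mono) (simp add: r_def)
    then show ?thesis by (simp add: z_def real_sqrt_mult)
  qed
  with \<epsilon> show ?thesis
    by (intro exI[of _ \<epsilon>] conjI ballI)
qed

subsection \<open>Trigonometric polynomials on the torus\<close>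

lemma prob_space_unit_interval: "prob_space (restrict_space lborel {0..1::real})"
  by (rule prob_space_restrict_space) auto

lemma product_prob_space_unit_interval:
  "product_prob_space (\<lambda>_::nat. restrict_space lborel {0..1::real})"
  using prob_space_unit_interval
  by (simp add: product_prob_space_def product_prob_space_axioms_def product_sigma_finite_def
      prob_space_imp_sigma_finite)

lemma space_torus: "space (torus d) = {..<d} \<rightarrow>\<^sub>E {0..1}"
  by (simp add: torus_def space_PiM space_restrict_space)

lemma prob_space_torus: "prob_space (torus d)"
  unfolding torus_def
  by (intro prob_space.prob_space_completion prob_space_PiM prob_space_unit_interval)

lemma trig_borel_measurable_PiM:
  "trig d k \<in> borel_measurable (PiM {..<d} (\<lambda>_. restrict_space lborel {0..1}))"
proof -
  have [measurable]: "(\<lambda>x. x i) \<in> borel_measurable (PiM {..<d} (\<lambda>_. restrict_space lborel {0..1::real}))"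
    if "i \<in> {..<d}" for i
    using measurable_compose[OF measurable_component_singleton[OF that] measurable_restrict_space1[of "\<lambda>x. x" lborel borel]]
    by simp
  show ?thesis unfolding trig_def by measurable
qed

lemma trig_borel_measurable [measurable]: "trig d k \<in> borel_measurable (torus d)"
  unfolding torus_def by (intro measurable_completion trig_borel_measurable_PiM)

lemma trig_poly_borel_measurable [measurable]: "trig_poly d K c \<in> borel_measurable (torus d)"
  unfolding trig_poly_def by measurable

lemma norm_trig [simp]: "cmod (trig d k x) = 1"
proof -
  have "trig d k x = exp (\<i> * complex_of_real (2 * pi * (\<Sum>i<d. of_int (k i) * x i)))"
    by (simp add: trig_def mult_ac)
  then show ?thesis by (simp only: norm_exp_i_times)
qed

lemma integrable_trig: "integrable (torus d) (trig d k)"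
proof -
  interpret prob_space "torus d" by (rule prob_space_torus)
  show ?thesis by (rule integrable_const_bound[of _ 1]) auto
qed

lemma integral_unit_interval_exp:
  "(LINT t|restrict_space lborel {0..1}. exp (2 * complex_of_real pi * \<i> * of_int k * complex_of_real t)) =
     (if k = 0 then 1 else 0)"
proof -
  define c where "c = 2 * complex_of_real pi * \<i> * of_int k"
  have "(LINT t|restrict_space lborel {0..1}. exp (c * complex_of_real t)) =
          (LINT t|lborel. indicator {0..1} t *\<^sub>R exp (c * complex_of_real t))"
    by (rule integral_restrict_space) simp
  also have "\<dots> = (if k = 0 then 1 else 0)"
  proof (cases "k = 0")
    case True
    then show ?thesis by (simp add: c_def)
  next
    case False
    then have c: "c \<noteq> 0" by (simp add: c_def)
    have "(LINT t|lborel. indicator {0..1} t *\<^sub>R exp (c * complex_of_real t)) =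
            exp (c * complex_of_real 1) / c - exp (c * complex_of_real 0) / c"
    proof (rule integral_FTC_atLeastAtMost)
      fix t :: real
      show "((\<lambda>t. exp (c * complex_of_real t) / c) has_vector_derivative exp (c * complex_of_real t))
              (at t within {0..1})"
        using c by (intro has_vector_derivative_real_field[where f="\<lambda>z. exp (c * z) / c"])
          (auto intro!: derivative_eq_intros)
    qed (auto intro!: continuous_intros)
    also have "exp (c * complex_of_real 1) = 1"
      unfolding c_def by (simp add: exp_eq_1)
    finally show ?thesis using False by simp
  qed
  finally show ?thesis by (simp add: c_def)
qed

text \<open>The condition is restricted to i < d because the lemma is applied to differences of
  extensional frequencies, and these are 0 rather than \<open>undefined\<close> beyond
  \<open>d\<close>.\<close>

lemma integral_trig: "(LINT x|torus d. trig d k x) = (if \<forall>i<d. k i = 0 then 1 else 0)"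
proof -
  let ?I = "restrict_space lborel {0..1::real}"
  interpret product_prob_space "\<lambda>_::nat. ?I"
    by (rule product_prob_space_unit_interval)
  let ?e = "\<lambda>i t. exp (2 * complex_of_real pi * \<i> * of_int (k i) * complex_of_real t)"
  have "trig d k = (\<lambda>x. \<Prod>i<d. ?e i (x i))"
    by (auto simp: trig_def exp_sum[symmetric] sum_distrib_left mult_ac fun_eq_iff)
  moreover have "(LINT x|torus d. trig d k x) = (LINT x|PiM {..<d} (\<lambda>_. ?I). trig d k x)"
    unfolding torus_def by (rule integral_completion[OF trig_borel_measurable_PiM])
  moreover have "(LINT x|PiM {..<d} (\<lambda>_. ?I). (\<Prod>i<d. ?e i (x i))) = (\<Prod>i<d. LINT t|?I. ?e i t)"
  proof (rule product_integral_prod)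
    fix i
    have "?e i \<in> borel_measurable ?I"
      by (intro measurable_restrict_space1) measurable
    moreover have "cmod (?e i t) = 1" for t
      using norm_exp_i_times[of "2 * pi * of_int (k i) * t"] by (simp add: mult_ac)
    ultimately show "integrable ?I (?e i)"
      by (intro finite_measure.integrable_const_bound[of _ _ 1])
        (auto intro: prob_space.finite_measure prob_space_unit_interval)
  qed simp
  ultimately have "(LINT x|torus d. trig d k x) = (\<Prod>i<d. if k i = 0 then 1 else 0)"
    by (simp only: integral_unit_interval_exp)
  then show ?thesis by (auto simp: prod_zero_iff)
qed

lemma trig_mult_cnj: "trig d k x * cnj (trig d l x) = trig d (\<lambda>i. k i - l i) x"
proof -
  have "cnj (trig d l x) = exp (- (2 * complex_of_real pi * \<i> * complex_of_real (\<Sum>i<d. of_int (l i) * x i)))"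
    by (simp add: trig_def exp_cnj)
  then show ?thesis
    by (simp add: trig_def flip: exp_add) (simp add: algebra_simps sum_subtractf)
qed

text \<open>Parseval's identity, by expanding the square and integrating the characters k -
  l.\<close>

lemma L2_norm_trig_poly:
  assumes K: "K \<subseteq> frequencies d" "finite K"
  shows "(L2_norm d (trig_poly d K c))\<^sup>2 = (\<Sum>k\<in>K. (cmod (c k))\<^sup>2)"
proof -
  have eq: "complex_of_real ((cmod (trig_poly d K c x))\<^sup>2) =
          (\<Sum>k\<in>K. \<Sum>l\<in>K. c k * cnj (c l) * trig d (\<lambda>i. k i - l i) x)" for x
  proof -
    have "complex_of_real ((cmod (trig_poly d K c x))\<^sup>2) = trig_poly d K c x * cnj (trig_poly d K c x)"
      by (rule complex_norm_square)
    also have "\<dots> = (\<Sum>k\<in>K. \<Sum>l\<in>K. c k * cnj (c l) * (trig d k x * cnj (trig d l x)))"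
      unfolding trig_poly_def cnj_sum sum_product by (simp add: mult_ac)
    finally show ?thesis by (simp only: trig_mult_cnj)
  qed
  have "complex_of_real (LINT x|torus d. (cmod (trig_poly d K c x))\<^sup>2) =
          (LINT x|torus d. (\<Sum>k\<in>K. \<Sum>l\<in>K. c k * cnj (c l) * trig d (\<lambda>i. k i - l i) x))"
    unfolding eq[symmetric] by (simp del: of_real_power)
  also have "\<dots> = (\<Sum>k\<in>K. \<Sum>l\<in>K. c k * cnj (c l) * (LINT x|torus d. trig d (\<lambda>i. k i - l i) x))"
    by (simp add: integrable_trig)
  also have "\<dots> = (\<Sum>k\<in>K. \<Sum>l\<in>K. if k = l then c k * cnj (c l) else 0)"
  proof (intro sum.cong refl)
    fix k l assume "k \<in> K" "l \<in> K"
    then have "k \<in> {..<d} \<rightarrow>\<^sub>E UNIV" "l \<in> {..<d} \<rightarrow>\<^sub>E UNIV"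
      using K by (auto simp: frequencies_def)
    \<comment> \<open>Extensionality is what makes distinct elements of \<open>K\<close> distinct
      characters.\<close>
    then have "(\<forall>i<d. k i - l i = 0) \<longleftrightarrow> k = l"
      by (auto intro: PiE_ext)
    then show "c k * cnj (c l) * (LINT x|torus d. trig d (\<lambda>i. k i - l i) x) =
                 (if k = l then c k * cnj (c l) else 0)"
      by (simp add: integral_trig)
  qed
  also have "\<dots> = (\<Sum>k\<in>K. c k * cnj (c k))"
    using K by (intro sum.cong refl) (simp add: sum.delta)
  also have "\<dots> = complex_of_real (\<Sum>k\<in>K. (cmod (c k))\<^sup>2)"
    by (simp add: complex_norm_square del: of_real_power)
  finally have "(LINT x|torus d. (cmod (trig_poly d K c x))\<^sup>2) = (\<Sum>k\<in>K. (cmod (c k))\<^sup>2)"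
    by (simp only: of_real_eq_iff)
  then show ?thesis by (simp add: L2_norm_def sum_nonneg)
qed

lemma continuous_on_trig: "continuous_on UNIV (trig d k)"
  unfolding trig_def by (intro continuous_intros continuous_on_product_coordinates)

lemma trig_periodic:
  assumes "\<forall>i<d. x i - y i \<in> \<int>"
  shows "trig d k x = trig d k y"
proof -
  have "(\<Sum>i<d. real_of_int (k i) * (x i - y i)) \<in> \<int>"
    using assms by (intro Ints_sum Ints_mult) auto
  then obtain z where "(\<Sum>i<d. real_of_int (k i) * (x i - y i)) = real_of_int z"
    by (elim Ints_cases)
  then have z: "(\<Sum>i<d. real_of_int (k i) * x i) = (\<Sum>i<d. real_of_int (k i) * y i) + real_of_int z"
    by (simp add: right_diff_distrib sum_subtractf)
  have "exp (2 * complex_of_real pi * \<i> * of_int z) = 1"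
    by (simp add: exp_eq_1)
  then show ?thesis
    unfolding trig_def z by (simp add: distrib_left exp_add)
qed

lemma trig_poly_continuous: "trig_poly d K c \<in> torus_continuous d"
  unfolding torus_continuous_def trig_poly_def
  using trig_periodic continuous_on_trig
  by (auto intro!: continuous_intros sum.cong) 

lemma finite_freq_cube: "finite (freq_cube d M)"
  unfolding freq_cube_def by (intro finite_PiE) auto

lemma card_freq_cube: "card (freq_cube d M) = (2 * M + 1) ^ d"
  unfolding freq_cube_def by (simp add: card_PiE nat_add_distrib nat_mult_distrib)

lemma freq_cube_subset: "freq_cube d M \<subseteq> frequencies d"
  unfolding freq_cube_def frequencies_def by (intro PiE_mono) auto

lemma trig_span_continuous: "f \<in> trig_span d M \<Longrightarrow> f \<in> torus_continuous d"
  using trig_poly_continuous by (auto simp: trig_span_def)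

lemma trig_span_measurable: "f \<in> trig_span d M \<Longrightarrow> f \<in> borel_measurable (torus d)"
  using trig_poly_borel_measurable by (auto simp: trig_span_def)

lemma trig_poly_extend:
  assumes "finite L" "K \<subseteq> L"
  shows "trig_poly d K c = trig_poly d L (\<lambda>k. if k \<in> K then c k else 0)"
  unfolding trig_poly_def using assms
  by (intro ext sum.mono_neutral_cong_left) auto

lemma norm_trig_poly_le: "cmod (trig_poly d K c x) \<le> (\<Sum>k\<in>K. cmod (c k))"
  unfolding trig_poly_def by (rule order_trans[OF norm_sum]) (simp add: norm_mult)

lemma bounded_function_space_trig_span: "bounded_function_space (trig_span d M) D"
proof
  show "(\<lambda>_. 0) \<in> trig_span d M"
    unfolding trig_span_def by (rule range_eqI[of _ _ "\<lambda>_. 0"]) (auto simp: trig_poly_def)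
  fix f assume "f \<in> trig_span d M"
  then obtain a where f: "f = trig_poly d (freq_cube d M) a" by (auto simp: trig_span_def)
  show "\<exists>B. \<forall>x\<in>D. cmod (f x) \<le> B"
    unfolding f using norm_trig_poly_le by blast
  show "(\<lambda>x. c * f x) \<in> trig_span d M" for c
    unfolding trig_span_def f
    by (rule range_eqI[of _ _ "\<lambda>k. c * a k"]) (auto simp: trig_poly_def sum_distrib_left mult_ac)
  fix g assume "g \<in> trig_span d M"
  then obtain b where g: "g = trig_poly d (freq_cube d M) b" by (auto simp: trig_span_def)
  show "(\<lambda>x. f x + g x) \<in> trig_span d M"
    unfolding trig_span_def f g
    by (rule range_eqI[of _ _ "\<lambda>k. a k + b k"]) (auto simp: trig_poly_def sum.distrib distrib_right)
qed

section \<open>Bounds for the norms and the approximation errors\<close>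

text \<open>Gives the infimum in \<open>best_term_approx\<close> a lower bound. For a non-measurable
  function the essential supremum is infinite, and \<open>real_of_ereal\<close> sends it to
  0.\<close>

lemma Linf_norm_nonneg: "0 \<le> Linf_norm d f"
proof (cases "(\<lambda>x. ereal (cmod (f x))) \<in> borel_measurable (torus d)")
  case True
  interpret prob_space "torus d" by (rule prob_space_torus)
  have "(0::ereal) = esssup (torus d) (\<lambda>_. 0)"
    by (rule esssup_const[symmetric]) (simp add: emeasure_space_1)
  also have "\<dots> \<le> esssup (torus d) (\<lambda>x. ereal (cmod (f x)))"
    by (rule esssup_mono) auto
  finally show ?thesis unfolding Linf_norm_def by (rule real_of_ereal_pos)
next
  case False
  then show ?thesis by (simp add: Linf_norm_def esssup_non_measurable top_ereal_def)
qed

lemma Linf_norm_le: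
  assumes [measurable]: "f \<in> borel_measurable (torus d)"
    and "\<And>x. x \<in> space (torus d) \<Longrightarrow> cmod (f x) \<le> B"
  shows "Linf_norm d f \<le> B"
proof -
  interpret prob_space "torus d" by (rule prob_space_torus)
  obtain x where "x \<in> space (torus d)" using not_empty by blast
  then have "0 \<le> B" using assms(2) norm_ge_zero order_trans by blast
  have "(0::ereal) = esssup (torus d) (\<lambda>_. 0)"
    by (rule esssup_const[symmetric]) (simp add: emeasure_space_1)
  also have "\<dots> \<le> esssup (torus d) (\<lambda>x. ereal (cmod (f x)))"
    by (rule esssup_mono) auto
  finally have "real_of_ereal (esssup (torus d) (\<lambda>x. ereal (cmod (f x)))) \<le> real_of_ereal (ereal B)"
    using assms(2) by (intro real_of_ereal_positive_mono esssup_I) auto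
  then show ?thesis by (simp add: Linf_norm_def)
qed

lemma L2_norm_le:
  assumes [measurable]: "f \<in> borel_measurable (torus d)"
    and "\<And>x. x \<in> space (torus d) \<Longrightarrow> cmod (f x) \<le> B"
  shows "(L2_norm d f)\<^sup>2 \<le> B\<^sup>2"
proof -
  interpret prob_space "torus d" by (rule prob_space_torus)
  have "(LINT x|torus d. (cmod (f x))\<^sup>2) \<le> (LINT x|torus d. B\<^sup>2)"
  proof (rule integral_mono)
    show "integrable (torus d) (\<lambda>x. (cmod (f x))\<^sup>2)"
      using assms(2) by (intro integrable_const_bound[of _ "B\<^sup>2"]) (auto intro!: AE_I2 power_mono)
  qed (use assms(2) in \<open>auto intro!: power_mono\<close>)
  then show ?thesis by (simp add: L2_norm_def prob_space)
qed

lemma best_term_approx_le: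
  assumes f: "f \<in> borel_measurable (torus d)"
    and K: "K \<subseteq> frequencies d" "finite K" "card K \<le> s"
    and "\<And>x. x \<in> space (torus d) \<Longrightarrow> cmod (f x - trig_poly d K c x) \<le> B"
  shows "best_term_approx d s f \<le> B"
proof -
  have "best_term_approx d s f \<le> Linf_norm d (\<lambda>x. f x - trig_poly d K c x)"
    unfolding best_term_approx_def
    using K by (intro cInf_lower bdd_belowI[of _ 0]) (auto simp: Linf_norm_nonneg)
  also have "\<dots> \<le> B"
    using assms by (intro Linf_norm_le) auto
  finally show ?thesis .
qed

text \<open>Eliminates the unspecified norm \<open>Y\<close>: \<open>f\<close> is its own
  approximant. Nonnegativity of \<open>Y\<close> on the span makes the infimum a lower
  bound.\<close>

lemma best_cube_approx_le_0:
  assumes Y: "norm_on_continuous d Y" and f: "f \<in> trig_span d M"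
  shows "best_cube_approx d M Y f \<le> 0"
proof -
  interpret bounded_function_space "trig_span d M" "space (torus d)"
    by (rule bounded_function_space_trig_span)
  have nonneg: "0 \<le> Y g" and zero_iff: "Y g = 0 \<longleftrightarrow> g = (\<lambda>_. 0)" if "g \<in> trig_span d M" for g
    using Y trig_span_continuous[OF that] by (auto simp: norm_on_continuous_def)
  have "best_cube_approx d M Y f \<le> Y (\<lambda>x. f x - f x)"
    unfolding best_cube_approx_def
    using f by (intro cINF_lower bdd_belowI2[of _ 0] nonneg diff)
  also have "\<dots> = 0"
    using zero_iff[OF zero] by simp
  finally show ?thesis .
qed

subsection \<open>The null space property\<close>

text \<open>Since \<open>T\<close> sees no difference between \<open>h\<close> and 0, which it has to reconstruct exactly,
  the hypothesis on the recovery map yields a null space property.\<close>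

lemma null_space_property:
  assumes "C > 0" and Y: "norm_on_continuous d Y"
    and T: "T \<in> ({..<m} \<rightarrow>\<^sub>E UNIV) \<rightarrow> torus_L2 d"
    and rec: "\<And>f. f \<in> torus_continuous d \<Longrightarrow>
         L2_norm d (\<lambda>x. f x - T (samples m X f) x) \<le> C * (best_term_approx d s f + best_cube_approx d M Y f)"
    and h: "h \<in> trig_span d M" and h0: "\<And>j. j < m \<Longrightarrow> h (X j) = 0"
  shows "L2_norm d h \<le> C * best_term_approx d s h"
proof -
  interpret bounded_function_space "trig_span d M" "space (torus d)"
    by (rule bounded_function_space_trig_span)
  define T0 where "T0 = T (samples m X (\<lambda>_. 0))"
  have "samples m X (\<lambda>_. 0) \<in> {..<m} \<rightarrow>\<^sub>E UNIV" by (auto simp: samples_def)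
  then have "T0 \<in> torus_L2 d" unfolding T0_def using T by blast
  then have T0 [measurable]: "T0 \<in> borel_measurable (torus d)"
    and int: "integrable (torus d) (\<lambda>x. (cmod (T0 x))\<^sup>2)"
    by (auto simp: torus_L2_def)
  have "best_term_approx d s (\<lambda>_. 0) \<le> 0"
    by (rule best_term_approx_le[where K="{}"]) (auto simp: trig_poly_def)
  moreover have "best_cube_approx d M Y (\<lambda>_. 0) \<le> 0"
    by (rule best_cube_approx_le_0[OF Y zero])
  moreover have "L2_norm d (\<lambda>x. 0 - T0 x) \<le>
      C * (best_term_approx d s (\<lambda>_. 0) + best_cube_approx d M Y (\<lambda>_. 0))"
    unfolding T0_def by (rule rec[OF trig_span_continuous[OF zero]])
  ultimately have "L2_norm d (\<lambda>x. 0 - T0 x) \<le> 0"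
    using \<open>C > 0\<close> by (smt (verit) mult_nonneg_nonpos)
  then have "(LINT x|torus d. (cmod (T0 x))\<^sup>2) \<le> 0"
    by (simp add: L2_norm_def)
  then have "(LINT x|torus d. (cmod (T0 x))\<^sup>2) = 0"
    by (intro antisym) auto
  \<comment> \<open>Integrability from \<open>torus_L2\<close> matters here, since the integral of a
    non-integrable function is 0 by default. The representative \<open>T0\<close> itself need not be
    the zero function.\<close>
  then have "AE x in torus d. T0 x = 0"
    using integral_nonneg_eq_0_iff_AE[OF int] by simp
  moreover have hm [measurable]: "h \<in> borel_measurable (torus d)" by (rule trig_span_measurable[OF h])
  ultimately have "(LINT x|torus d. (cmod (h x - T0 x))\<^sup>2) = (LINT x|torus d. (cmod (h x))\<^sup>2)"
    by (intro integral_cong_AE) auto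
  then have "L2_norm d h = L2_norm d (\<lambda>x. h x - T0 x)"
    by (simp add: L2_norm_def)
  also have "samples m X h = samples m X (\<lambda>_. 0)"
    using h0 by (auto simp: samples_def)
  then have "L2_norm d (\<lambda>x. h x - T0 x) \<le> C * (best_term_approx d s h + best_cube_approx d M Y h)"
    using rec[OF trig_span_continuous[OF h]] by (simp add: T0_def)
  also have "\<dots> \<le> C * (best_term_approx d s h + 0)"
    using \<open>C > 0\<close> best_cube_approx_le_0[OF Y h] by (intro mult_left_mono add_left_mono) auto
  finally show ?thesis by simp
qed

subsection \<open>Sparse trigonometric polynomials with small supremum norm\<close>

lemma norm_exp_i_diff_le: "cmod (exp (\<i> * complex_of_real a) - exp (\<i> * complex_of_real b)) \<le> \<bar>a - b\<bar>"
proof -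
  have "exp (\<i> * complex_of_real a) - exp (\<i> * complex_of_real b) =
          exp (\<i> * complex_of_real b) * (exp (\<i> * complex_of_real (a - b)) - 1)"
    by (simp add: right_diff_distrib flip: exp_add)
  then have "cmod (exp (\<i> * complex_of_real a) - exp (\<i> * complex_of_real b)) = 2 * \<bar>sin ((a - b) / 2)\<bar>"
    by (simp only: norm_mult norm_exp_i_times dist_exp_i_1)
  then show ?thesis
    using abs_sin_x_le_abs_x[of "(a - b) / 2"] by simp
qed

text \<open>Serves to pass from a grid of mesh \<eta> to the whole cube.\<close>

lemma trig_lipschitz:
  assumes k: "k \<in> freq_cube d M" and xy: "\<And>i. i < d \<Longrightarrow> \<bar>x i - y i\<bar> \<le> \<eta>"
  shows "cmod (trig d k x - trig d k y) \<le> 2 * pi * (real d * (real M * \<eta>))"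
proof -
  have trig: "trig d k z = exp (\<i> * complex_of_real (2 * pi * (\<Sum>i<d. of_int (k i) * z i)))" for z
    by (simp add: trig_def mult_ac)
  define S where "S = (\<Sum>i<d. of_int (k i) * (x i - y i))"
  have "S = (\<Sum>i<d. of_int (k i) * x i) - (\<Sum>i<d. of_int (k i) * y i)"
    unfolding S_def right_diff_distrib by (rule sum_subtractf)
  then have "2 * pi * (\<Sum>i<d. of_int (k i) * x i) - 2 * pi * (\<Sum>i<d. of_int (k i) * y i) = 2 * pi * S"
    by (simp only: right_diff_distrib)
  then have *: "cmod (trig d k x - trig d k y) \<le> 2 * pi * \<bar>S\<bar>"
    using norm_exp_i_diff_le[of "2 * pi * (\<Sum>i<d. of_int (k i) * x i)" "2 * pi * (\<Sum>i<d. of_int (k i) * y i)"]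
    unfolding trig by (simp only: abs_mult) simp
  have "\<bar>S\<bar> \<le> (\<Sum>i<d. \<bar>of_int (k i) * (x i - y i)\<bar>)"
    unfolding S_def by (rule sum_abs)
  moreover have "(\<Sum>i<d. \<bar>of_int (k i) * (x i - y i)\<bar>) \<le> (\<Sum>i<d. real M * \<eta>)"
  proof (rule sum_mono)
    fix i assume i: "i \<in> {..<d}"
    then have "k i \<in> {- int M..int M}" using k unfolding freq_cube_def by (rule PiE_mem[rotated])
    then have "\<bar>real_of_int (k i)\<bar> \<le> real M" by auto
    moreover have "\<bar>x i - y i\<bar> \<le> \<eta>" using xy i by simp
    ultimately show "\<bar>of_int (k i) * (x i - y i)\<bar> \<le> real M * \<eta>"
      unfolding abs_mult by (intro mult_mono) simp_all
  qed
  ultimately have "\<bar>S\<bar> \<le> real d * (real M * \<eta>)" by simp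
  then have "2 * pi * \<bar>S\<bar> \<le> 2 * pi * (real d * (real M * \<eta>))"
    by (rule mult_left_mono) simp
  with * show ?thesis by (rule order_trans)
qed

text \<open>The signs are chosen for the points of a grid of mesh 1/G. The condition on
  \<open>G\<close> makes the Lipschitz errors of all \<open>card I\<close> terms add up to at most
  1.\<close>

lemma small_sign_poly_ex:
  assumes I: "I \<subseteq> freq_cube d M" "I \<noteq> {}"
    and G: "2 * pi * (real (card I) * real d * real M) \<le> real G" "G \<ge> 1"
  shows "\<exists>\<epsilon>. (\<forall>k. \<epsilon> k \<in> {-1, 1}) \<and>
           (\<forall>x\<in>{..<d} \<rightarrow>\<^sub>E {0..1}. cmod (trig_poly d I (\<lambda>k. of_real (\<epsilon> k)) x) \<le>
              2 * sqrt (real (card I) * ln (4 * real ((G + 1) ^ d))) + 1)"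
proof -
  have finI: "finite I" using I finite_freq_cube finite_subset by blast
  define P where "P = ({..<d} \<rightarrow>\<^sub>E {0..G})"
  have P: "finite P" "P \<noteq> {}" "card P = (G + 1) ^ d"
    by (auto simp: P_def finite_PiE PiE_eq_empty_iff card_PiE)
  define pt where "pt = (\<lambda>(p :: nat \<Rightarrow> nat) i. real (p i) / real G)"
  have "\<exists>\<epsilon>. (\<forall>k. \<epsilon> k \<in> {-1, 1}) \<and>
          (\<forall>p\<in>P. cmod (\<Sum>k\<in>I. of_real (\<epsilon> k) * trig d k (pt p)) \<le>
             2 * sqrt (real (card I) * ln (4 * real (card P))))"
    by (rule signs_complex_ex[OF finI I(2) P(1,2)]) simp
  then obtain \<epsilon> where \<epsilon>: "\<forall>k. \<epsilon> k \<in> {-1, 1::real}" and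
    le: "\<forall>p\<in>P. cmod (\<Sum>k\<in>I. of_real (\<epsilon> k) * trig d k (pt p)) \<le>
           2 * sqrt (real (card I) * ln (4 * real (card P)))"
    by (elim exE conjE) (rule that)
  have "cmod (trig_poly d I (\<lambda>k. of_real (\<epsilon> k)) x) \<le>
          2 * sqrt (real (card I) * ln (4 * real ((G + 1) ^ d))) + 1"
    if x: "x \<in> {..<d} \<rightarrow>\<^sub>E {0..1}" for x
  proof -
    \<comment> \<open>Rounding down to the grid; the coordinate value 1 yields the index
      \<open>G\<close>, hence G + 1 grid points per axis.\<close>
    define p where "p = (\<lambda>i\<in>{..<d}. nat \<lfloor>x i * real G\<rfloor>)"
    have xi: "0 \<le> x i" "x i \<le> 1" if "i < d" for i
      using PiE_mem[OF x, of i] that by simp_all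
    have "p \<in> P"
      unfolding P_def p_def
    proof (intro restrict_PiE_iff[THEN iffD2] ballI)
      fix i assume "i \<in> {..<d}"
      then have "x i * real G \<le> 1 * real G" using xi by (intro mult_right_mono) auto
      then have "\<lfloor>x i * real G\<rfloor> \<le> int G" by linarith
      then show "nat \<lfloor>x i * real G\<rfloor> \<in> {0..G}" by (simp add: nat_le_iff)
    qed
    have close: "\<bar>x i - pt p i\<bar> \<le> 1 / real G" if "i < d" for i
    proof -
      have "0 \<le> x i * real G" using xi[OF that] by simp
      then have "real (p i) = of_int \<lfloor>x i * real G\<rfloor>"
        using that by (simp add: p_def)
      then have "\<bar>x i * real G - real (p i)\<bar> \<le> 1" by linarith
      then have "\<bar>(x i - pt p i) * real G\<bar> \<le> 1"
        using G(2) by (simp add: pt_def left_diff_distrib)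
      then show ?thesis using G(2) by (simp add: abs_mult pos_le_divide_eq)
    qed
    have split: "cmod (trig_poly d I (\<lambda>k. of_real (\<epsilon> k)) x) \<le>
            cmod (\<Sum>k\<in>I. of_real (\<epsilon> k) * trig d k (pt p)) +
            cmod (\<Sum>k\<in>I. of_real (\<epsilon> k) * (trig d k x - trig d k (pt p)))"
    proof -
      have "trig_poly d I (\<lambda>k. of_real (\<epsilon> k)) x =
              (\<Sum>k\<in>I. of_real (\<epsilon> k) * trig d k (pt p)) +
              (\<Sum>k\<in>I. of_real (\<epsilon> k) * (trig d k x - trig d k (pt p)))"
        unfolding trig_poly_def sum.distrib[symmetric]
        by (intro sum.cong refl) (simp add: right_diff_distrib)
      then show ?thesis by (simp only: norm_triangle_ineq)
    qed
    have "cmod (\<Sum>k\<in>I. of_real (\<epsilon> k) * (trig d k x - trig d k (pt p))) \<le>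
                 (\<Sum>k\<in>I. 2 * pi * (real d * (real M * (1 / real G))))"
    proof (rule order_trans[OF norm_sum], rule sum_mono)
      fix k assume "k \<in> I"
      have "\<bar>\<epsilon> k\<bar> = 1" using \<epsilon>[rule_format, of k] by auto
      then have "cmod (of_real (\<epsilon> k) * (trig d k x - trig d k (pt p))) =
                         cmod (trig d k x - trig d k (pt p))"
        by (simp add: norm_mult)
      also have "\<dots> \<le> 2 * pi * (real d * (real M * (1 / real G)))"
        using \<open>k \<in> I\<close> I(1) close by (intro trig_lipschitz) blast+
      finally show "cmod (of_real (\<epsilon> k) * (trig d k x - trig d k (pt p))) \<le>
                      2 * pi * (real d * (real M * (1 / real G)))" .
    qed
    also have "\<dots> = 2 * pi * (real (card I) * real d * real M) / real G" by simp
    also have "\<dots> \<le> 1" using G by simp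
    finally show ?thesis
      using split le[rule_format, OF \<open>p \<in> P\<close>] unfolding P(3) by linarith
  qed
  with \<epsilon> show ?thesis by (intro exI[of _ \<epsilon>] conjI ballI)
qed

text \<open>Evaluates the bound of \<open>small_sign_poly_ex\<close> for G = 7 n d M. As n, d and M
  are all at most N, each axis has at most N^5 grid points; with 4 \<le> N^(2d), the logarithm is at
  most 7 d ln N.\<close>

lemma sup_radius_le:
  fixes d M n :: nat
  defines "N \<equiv> (2 * real M + 1) ^ d"
  assumes "d \<ge> 1" "M \<ge> 1" "n \<ge> 1" "real n \<le> N"
  shows "2 * sqrt (real n * ln (4 * real ((7 * n * d * M + 1) ^ d))) + 1 \<le> 7 * sqrt (real n * (real d * ln N))"
    and "real d * ln N \<ge> 1"
proof -
  have "2 * real M + 1 \<le> N"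
    unfolding N_def using assms by (intro self_le_power) auto
  then have N3: "N \<ge> 3" and MN: "real M \<le> N" using assms by auto
  have "real d \<le> 2 ^ d" using of_nat_less_two_power[of d, where 'a=real] by linarith
  also have "\<dots> \<le> N" unfolding N_def using assms by (intro power_mono) auto
  finally have dN: "real d \<le> N" .
  have lnN: "ln N \<ge> 1"
    using N3 exp_le ln_ge_iff[of N 1] by linarith
  show dl: "real d * ln N \<ge> 1"
    using mult_mono[of 1 "real d" 1 "ln N"] lnN assms by simp
  have "7 * n * d * M + 1 \<le> 8 * (n * d * M)" using assms(2-4) by simp
  then have "real (7 * n * d * M + 1) \<le> real (8 * (n * d * M))"
    by (rule of_nat_mono)
  also have "\<dots> = 8 * (real n * real d * real M)" by simp
  also have "\<dots> \<le> 8 * (N * N * N)"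
    using assms(5) dN MN N3 by (intro mult_left_mono mult_mono) auto
  also have "\<dots> \<le> N\<^sup>2 * (N * N * N)"
    using power_mono[OF N3, of 2] N3 by (intro mult_right_mono) auto
  also have "\<dots> = N ^ 5" by (simp add: eval_nat_numeral)
  finally have G: "real (7 * n * d * M + 1) \<le> N ^ 5" .
  have "4 * real ((7 * n * d * M + 1) ^ d) \<le> N ^ (2 * d) * (N ^ 5) ^ d"
  proof (intro mult_mono)
    have "4 \<le> N\<^sup>2" using power_mono[OF N3, of 2] by simp
    also have "\<dots> \<le> N ^ (2 * d)" using N3 assms by (intro power_increasing) auto
    finally show "4 \<le> N ^ (2 * d)" .
    show "real ((7 * n * d * M + 1) ^ d) \<le> (N ^ 5) ^ d"
      unfolding of_nat_power using G by (rule power_mono) simp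
  qed (use N3 in auto)
  also have "\<dots> = N ^ (7 * d)" by (simp flip: power_mult power_add)
  finally have "4 * real ((7 * n * d * M + 1) ^ d) \<le> N ^ (7 * d)" .
  moreover have "0 < real ((7 * n * d * M + 1) ^ d)"
    by (subst of_nat_0_less_iff) simp
  ultimately have "ln (4 * real ((7 * n * d * M + 1) ^ d)) \<le> ln (N ^ (7 * d))"
    by (intro ln_mono) auto
  also have "\<dots> = 7 * (real d * ln N)" using N3 by (simp add: ln_realpow)
  \<comment> \<open>A square constant, so that twice its root is 6; the summand 1 then makes
    7.\<close>
  also have "\<dots> \<le> 9 * (real d * ln N)" using dl by simp
  finally have "real n * ln (4 * real ((7 * n * d * M + 1) ^ d)) \<le> real n * (9 * (real d * ln N))"
    by (rule mult_left_mono) simp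
  also have "\<dots> = 9 * (real n * (real d * ln N))" by simp
  finally have "sqrt (real n * ln (4 * real ((7 * n * d * M + 1) ^ d))) \<le> sqrt (9 * (real n * (real d * ln N)))"
    by (rule real_sqrt_le_mono)
  also have "\<dots> = 3 * sqrt (real n * (real d * ln N))"
    by (simp add: real_sqrt_mult)
  finally have "2 * sqrt (real n * ln (4 * real ((7 * n * d * M + 1) ^ d))) \<le>
                  6 * sqrt (real n * (real d * ln N))"
    by simp
  moreover have "1 \<le> sqrt (real n * (real d * ln N))"
    using mult_mono[of 1 "real n" 1 "real d * ln N"] dl assms by simp
  ultimately show "2 * sqrt (real n * ln (4 * real ((7 * n * d * M + 1) ^ d))) + 1 \<le>
                     7 * sqrt (real n * (real d * ln N))"
    by linarith
qed

section \<open>Separation of the sign polynomials and the count of samples\<close>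

lemma trig_poly_in_span: "K \<subseteq> freq_cube d M \<Longrightarrow> trig_poly d K c \<in> trig_span d M"
  unfolding trig_span_def by (subst trig_poly_extend[OF finite_freq_cube]) auto

lemma integrable_norm_square_trig_span:
  assumes "f \<in> trig_span d M"
  shows "integrable (torus d) (\<lambda>x. (cmod (f x))\<^sup>2)"
proof -
  interpret prob_space "torus d" by (rule prob_space_torus)
  obtain c where f: "f = trig_poly d (freq_cube d M) c" using assms by (auto simp: trig_span_def)
  show ?thesis
    unfolding f using norm_trig_poly_le[of d "freq_cube d M" c]
    by (intro integrable_const_bound[of _ "(\<Sum>k\<in>freq_cube d M. cmod (c k))\<^sup>2"])
      (auto intro!: AE_I2 power_mono)
qed

text \<open>A pointwise substitute for the triangle inequality; the lost factor only affects
  C'.\<close>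

lemma L2_norm_add_square_le:
  assumes f: "f \<in> trig_span d M" and g: "g \<in> trig_span d M"
  shows "(L2_norm d (\<lambda>x. f x + g x))\<^sup>2 \<le> 2 * (L2_norm d f)\<^sup>2 + 2 * (L2_norm d g)\<^sup>2"
proof -
  interpret bounded_function_space "trig_span d M" "space (torus d)"
    by (rule bounded_function_space_trig_span)
  have pt: "(cmod (f x + g x))\<^sup>2 \<le> 2 * (cmod (f x))\<^sup>2 + 2 * (cmod (g x))\<^sup>2" for x
  proof -
    have "(cmod (f x + g x))\<^sup>2 \<le> (cmod (f x) + cmod (g x))\<^sup>2"
      by (intro power_mono norm_triangle_ineq) auto
    also have "\<dots> \<le> 2 * (cmod (f x))\<^sup>2 + 2 * (cmod (g x))\<^sup>2"
      using sum_squares_bound[of "cmod (f x)" "cmod (g x)"] by (simp add: power2_sum)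
    finally show ?thesis .
  qed
  note int = integrable_norm_square_trig_span[OF f] integrable_norm_square_trig_span[OF g]
  have "(LINT x|torus d. (cmod (f x + g x))\<^sup>2) \<le>
          (LINT x|torus d. 2 * (cmod (f x))\<^sup>2 + 2 * (cmod (g x))\<^sup>2)"
    using int integrable_norm_square_trig_span[OF add[OF f g]] pt by (intro integral_mono) auto
  also have "\<dots> = 2 * (LINT x|torus d. (cmod (f x))\<^sup>2) + 2 * (LINT x|torus d. (cmod (g x))\<^sup>2)"
    using int by simp
  finally show ?thesis by (simp add: L2_norm_def)
qed

text \<open>The difference h of the sparse polynomial and \<open>u\<close> vanishes at the samples,
  and approximating h by the sparse polynomial leaves the error \<open>u\<close>. So both h and
  \<open>u\<close> have \<open>L2_norm\<close> controlled by \<open>B\<close>. As \<open>u\<close>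
  is any representative, this bounds the quotient norm from below.\<close>

lemma sparse_L2_norm_le_quotient_norm:
  assumes "C > 0"
    and null_space: "\<And>h. h \<in> trig_span d M \<Longrightarrow> (\<And>j. j < m \<Longrightarrow> h (X j) = 0) \<Longrightarrow>
                       L2_norm d h \<le> C * best_term_approx d s h"
    and K: "K \<subseteq> freq_cube d M" "card K \<le> s" and u: "u \<in> trig_span d M"
    and uX: "\<And>j. j < m \<Longrightarrow> u (X j) = trig_poly d K c (X j)"
    and uB: "\<And>x. x \<in> space (torus d) \<Longrightarrow> cmod (u x) \<le> B"
  shows "(L2_norm d (trig_poly d K c))\<^sup>2 \<le> 2 * (C\<^sup>2 + 1) * B\<^sup>2"
proof -
  interpret bounded_function_space "trig_span d M" "space (torus d)"
    by (rule bounded_function_space_trig_span)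
  define h where "h = (\<lambda>x. trig_poly d K c x - u x)"
  have h: "h \<in> trig_span d M"
    unfolding h_def by (rule diff[OF trig_poly_in_span[OF K(1)] u])
  have "L2_norm d h \<le> C * best_term_approx d s h"
    using null_space[OF h] uX by (simp add: h_def)
  also have "best_term_approx d s h \<le> B"
  proof (rule best_term_approx_le[OF trig_span_measurable[OF h]])
    show "K \<subseteq> frequencies d" "finite K" "card K \<le> s"
      using K freq_cube_subset finite_subset[OF _ finite_freq_cube] by blast+
    show "cmod (h x - trig_poly d K c x) \<le> B" if "x \<in> space (torus d)" for x
      using uB[OF that] by (simp add: h_def)
  qed
  finally have "L2_norm d h \<le> C * B" using \<open>C > 0\<close> by simp
  then have "(L2_norm d h)\<^sup>2 \<le> (C * B)\<^sup>2"
    by (rule power_mono) (simp add: L2_norm_def)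
  moreover have "(L2_norm d u)\<^sup>2 \<le> B\<^sup>2"
    by (rule L2_norm_le[OF trig_span_measurable[OF u] uB])
  moreover have "(L2_norm d (trig_poly d K c))\<^sup>2 \<le> 2 * (L2_norm d h)\<^sup>2 + 2 * (L2_norm d u)\<^sup>2"
    using L2_norm_add_square_le[OF h u] by (simp add: h_def)
  ultimately show ?thesis by (simp add: algebra_simps power_mult_distrib)
qed

text \<open>Coefficients may cancel on the intersection, but they have modulus 1 on the symmetric
  difference, which has at least 2n - n elements; then Parseval applies.\<close>

lemma L2_norm_sign_poly_diff:
  fixes \<epsilon> \<epsilon>' :: "(nat \<Rightarrow> int) \<Rightarrow> real"
  assumes I: "I \<subseteq> frequencies d" "finite I" "card I = n" and J: "J \<subseteq> frequencies d" "finite J" "card J = n"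
    and IJ: "2 * card (I \<inter> J) \<le> n" and \<epsilon>: "\<And>k. \<epsilon> k \<in> {-1, 1}" "\<And>k. \<epsilon>' k \<in> {-1, 1}"
  defines "c \<equiv> \<lambda>k. complex_of_real ((if k \<in> I then \<epsilon> k else 0) - (if k \<in> J then \<epsilon>' k else 0))"
  shows "real n \<le> (L2_norm d (trig_poly d (I \<union> J) c))\<^sup>2"
    and "trig_poly d (I \<union> J) c x =
           trig_poly d I (\<lambda>k. of_real (\<epsilon> k)) x - trig_poly d J (\<lambda>k. of_real (\<epsilon>' k)) x"
    and "card (I \<union> J) \<le> 2 * n"
proof -
  have one: "\<bar>\<epsilon> k\<bar> = 1" "\<bar>\<epsilon>' k\<bar> = 1" for k
    using \<epsilon>[of k] by auto
  have "card I = card (I - J) + card (I \<inter> J)" "card J = card (J - I) + card (I \<inter> J)"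
    using I J card_Int_Diff[of I J] card_Int_Diff[of J I] by (simp_all add: Int_commute)
  then have "real n \<le> real (card (I - J)) + real (card (J - I))"
    using I J IJ by simp
  also have "\<dots> = (\<Sum>k\<in>(I - J) \<union> (J - I). 1)"
    using I J by (subst sum.union_disjoint) auto
  also have "\<dots> = (\<Sum>k\<in>(I - J) \<union> (J - I). (cmod (c k))\<^sup>2)"
  proof (intro sum.cong refl)
    fix k assume "k \<in> (I - J) \<union> (J - I)"
    then have "cmod (c k) = 1" using one[of k] by (auto simp: c_def)
    then show "1 = (cmod (c k))\<^sup>2" by simp
  qed
  also have "\<dots> \<le> (\<Sum>k\<in>I \<union> J. (cmod (c k))\<^sup>2)"
    using I J by (intro sum_mono2) auto
  also have "\<dots> = (L2_norm d (trig_poly d (I \<union> J) c))\<^sup>2"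
    using I J by (intro L2_norm_trig_poly[symmetric]) auto
  finally show "real n \<le> (L2_norm d (trig_poly d (I \<union> J) c))\<^sup>2" .
  have fin: "finite (I \<union> J)" using I J by simp
  show "trig_poly d (I \<union> J) c x =
          trig_poly d I (\<lambda>k. of_real (\<epsilon> k)) x - trig_poly d J (\<lambda>k. of_real (\<epsilon>' k)) x"
    unfolding trig_poly_extend[OF fin Un_upper1] trig_poly_extend[OF fin Un_upper2]
    by (auto simp: trig_poly_def c_def simp flip: sum_subtractf left_diff_distrib intro!: sum.cong)
  show "card (I \<union> J) \<le> 2 * n"
    using card_Un_le[of I J] I J by simp
qed

lemma packing_number_le:
  fixes d M m n :: nat
  defines "N \<equiv> (2 * real M + 1) ^ d"
  assumes "C > 0" "d \<ge> 1" "M \<ge> 1" "n \<ge> 1" "real n \<le> N"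
    and X: "X \<in> {..<m} \<rightarrow> ({..<d} \<rightarrow>\<^sub>E {0..1})"
    and null_space: "\<And>h. h \<in> trig_span d M \<Longrightarrow> (\<And>j. j < m \<Longrightarrow> h (X j) = 0) \<Longrightarrow>
                       L2_norm d h \<le> C * best_term_approx d (2 * n) h"
  shows "(N / (4 * real n)) powr (real n / 2) \<le> (112 * (C + 1) * (real d * ln N)) ^ (2 * m)"
proof -
  let ?Q = "freq_cube d M"
  interpret bounded_function_space "trig_span d M" "space (torus d)"
    by (rule bounded_function_space_trig_span)
  have cQ: "real (card ?Q) = N" by (simp add: card_freq_cube N_def add.commute)
  then have "n \<le> card ?Q" using \<open>real n \<le> N\<close> by linarith
  from almost_disjoint_family_ex[OF finite_freq_cube \<open>n \<ge> 1\<close> this]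
  obtain \<F> where subsets: "\<forall>I\<in>\<F>. I \<subseteq> ?Q \<and> card I = n"
    and inter: "\<forall>I\<in>\<F>. \<forall>J\<in>\<F>. I \<noteq> J \<longrightarrow> 2 * card (I \<inter> J) \<le> n"
    and large: "(N / (4 * real n)) powr (real n / 2) \<le> real (card \<F>)"
    unfolding cQ by (elim exE conjE) (rule that)
  have \<F>: "I \<subseteq> ?Q" "card I = n" if "I \<in> \<F>" for I
    using bspec[OF subsets that] by simp_all
  have \<F>': "I \<subseteq> frequencies d" "finite I" if "I \<in> \<F>" for I
    using \<F>(1)[OF that] freq_cube_subset finite_subset[OF _ finite_freq_cube] by blast+
  define t where "t = real d * ln N"
  define R where "R = 7 * sqrt (real n * t)"
  \<comment> \<open>Solves 2 (C^2 + 1) \<delta>^2 = n, the equality case of the quotient norm bound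
    for polynomials of squared norm n.\<close>
  define \<delta> where "\<delta> = sqrt (real n / (2 * (C\<^sup>2 + 1)))"
  have radius: "2 * sqrt (real n * ln (4 * real ((7 * n * d * M + 1) ^ d))) + 1 \<le> R"
    and t1: "t \<ge> 1"
    using sup_radius_le[of d M n] assms(3-6) unfolding R_def t_def N_def by blast+
  have C2: "2 * (C\<^sup>2 + 1) > 0" by (intro mult_pos_pos add_nonneg_pos) auto
  have \<delta>: "\<delta> > 0" and \<delta>2: "\<delta>\<^sup>2 = real n / (2 * (C\<^sup>2 + 1))"
    using C2 \<open>n \<ge> 1\<close> by (auto simp: \<delta>_def)
  have "\<exists>\<epsilon>. (\<forall>k. \<epsilon> k \<in> {-1, 1}) \<and>
          (\<forall>x\<in>{..<d} \<rightarrow>\<^sub>E {0..1}. cmod (trig_poly d I (\<lambda>k. of_real (\<epsilon> k)) x) \<le> R)" if I: "I \<in> \<F>" for I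
  proof -
    \<comment> \<open>The 7 in the grid size is an integer above 2 pi.\<close>
    have "2 * pi * (real n * real d * real M) \<le> 7 * (real n * real d * real M)"
      using pi_approx by (intro mult_right_mono) auto
    then have "2 * pi * (real (card I) * real d * real M) \<le> real (7 * n * d * M)"
      using \<F>(2)[OF I] by simp
    moreover have "I \<noteq> {}" using \<F>(2)[OF I] \<open>n \<ge> 1\<close> by auto
    moreover have "7 * n * d * M \<ge> 1" using assms(3-5) by simp
    ultimately have "\<exists>\<epsilon>. (\<forall>k. \<epsilon> k \<in> {-1, 1}) \<and>
        (\<forall>x\<in>{..<d} \<rightarrow>\<^sub>E {0..1}. cmod (trig_poly d I (\<lambda>k. of_real (\<epsilon> k)) x) \<le>
           2 * sqrt (real (card I) * ln (4 * real ((7 * n * d * M + 1) ^ d))) + 1)"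
      by (intro small_sign_poly_ex[OF \<F>(1)[OF I]])
    then obtain \<epsilon> where \<epsilon>: "\<forall>k. \<epsilon> k \<in> {-1, 1::real}"
      and le: "\<forall>x\<in>{..<d} \<rightarrow>\<^sub>E {0..1}. cmod (trig_poly d I (\<lambda>k. of_real (\<epsilon> k)) x) \<le>
                 2 * sqrt (real (card I) * ln (4 * real ((7 * n * d * M + 1) ^ d))) + 1"
      by (elim exE conjE) (rule that)
    have "cmod (trig_poly d I (\<lambda>k. of_real (\<epsilon> k)) x) \<le> R" if "x \<in> {..<d} \<rightarrow>\<^sub>E {0..1}" for x
      using bspec[OF le that] radius unfolding \<F>(2)[OF I] by (rule order_trans)
    with \<epsilon> show ?thesis by (intro exI[of _ \<epsilon>] conjI ballI)
  qed
  then have "\<forall>I\<in>\<F>. \<exists>\<epsilon>. (\<forall>k. \<epsilon> k \<in> {-1, 1}) \<and>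
      (\<forall>x\<in>{..<d} \<rightarrow>\<^sub>E {0..1}. cmod (trig_poly d I (\<lambda>k. of_real (\<epsilon> k)) x) \<le> R)"
    by (rule ballI)
  from bchoice[OF this] obtain \<epsilon> where choice: "\<forall>I\<in>\<F>. (\<forall>k. \<epsilon> I k \<in> {-1, 1::real}) \<and>
      (\<forall>x\<in>{..<d} \<rightarrow>\<^sub>E {0..1}. cmod (trig_poly d I (\<lambda>k. of_real (\<epsilon> I k)) x) \<le> R)"
    by (elim exE) (rule that)
  have \<epsilon>: "\<epsilon> I k \<in> {-1, 1}" if "I \<in> \<F>" for I k
    using bspec[OF choice that, THEN conjunct1] by (rule spec)
  have \<epsilon>R: "cmod (trig_poly d I (\<lambda>k. of_real (\<epsilon> I k)) x) \<le> R"
    if "I \<in> \<F>" "x \<in> {..<d} \<rightarrow>\<^sub>E {0..1}" for I x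
    using bspec[OF choice that(1), THEN conjunct2] that(2) by (rule bspec)
  define f where "f = (\<lambda>I. trig_poly d I (\<lambda>k. complex_of_real (\<epsilon> I k)))"
  have key: "\<delta> \<le> B"
    if IJ: "I \<in> \<F>" "J \<in> \<F>" "I \<noteq> J" and u: "u \<in> trig_span d M"
      and uX: "\<And>j. j < m \<Longrightarrow> u (X j) = f I (X j) - f J (X j)"
      and uB: "\<And>x. x \<in> space (torus d) \<Longrightarrow> cmod (u x) \<le> B" for I J u B
  proof -
    define c where
      "c = (\<lambda>k. complex_of_real ((if k \<in> I then \<epsilon> I k else 0) - (if k \<in> J then \<epsilon> J k else 0)))"
    note * = L2_norm_sign_poly_diff[where \<epsilon>="\<epsilon> I" and \<epsilon>'="\<epsilon> J", OF \<F>'[OF IJ(1)] \<F>(2)[OF IJ(1)] \<F>'[OF IJ(2)] \<F>(2)[OF IJ(2)]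
        inter[rule_format, OF IJ] \<epsilon>[OF IJ(1)] \<epsilon>[OF IJ(2)], folded c_def]
    have "(L2_norm d (trig_poly d (I \<union> J) c))\<^sup>2 \<le> 2 * (C\<^sup>2 + 1) * B\<^sup>2"
    proof (rule sparse_L2_norm_le_quotient_norm[where s="2 * n" and X=X and m=m])
      show "u (X j) = trig_poly d (I \<union> J) c (X j)" if "j < m" for j
        using uX[OF that] *(2) by (simp add: f_def)
    qed (use \<open>C > 0\<close> null_space \<F>(1) IJ *(3) u uB in auto)
    with *(1) have "real n \<le> 2 * (C\<^sup>2 + 1) * B\<^sup>2" by linarith
    then have "\<delta>\<^sup>2 \<le> B\<^sup>2" unfolding \<delta>2 using C2 by (simp add: field_simps)
    moreover have "B \<ge> 0"
      using uB prob_space.not_empty[OF prob_space_torus, of d] norm_ge_zero order_trans by blast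
    ultimately show ?thesis by (rule power2_le_imp_le)
  qed
  have inj: "inj_on f \<F>"
  proof (rule inj_onI, rule ccontr)
    fix I J assume "I \<in> \<F>" "J \<in> \<F>" "f I = f J" "I \<noteq> J"
    then have "\<delta> \<le> 0" by (intro key[of I J "\<lambda>_. 0"]) (auto simp: zero)
    with \<delta> show False by simp
  qed
  have "real (card (f ` \<F>)) \<le> (8 * R / \<delta>) ^ (2 * m)"
  proof (rule packing_bound)
    show "X ` {..<m} \<subseteq> space (torus d)" using X by (auto simp: space_torus)
    show "f ` \<F> \<subseteq> trig_span d M" using \<F>(1) by (auto simp: f_def intro!: trig_poly_in_span)
    show "cmod (g x) \<le> R" if "g \<in> f ` \<F>" "x \<in> space (torus d)" for g x
      using that \<epsilon>R by (auto simp: f_def space_torus)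
    have "\<delta> \<le> sqrt (real n * t)"
      unfolding \<delta>_def
    proof (intro real_sqrt_le_mono)
      have "real n / (2 * (C\<^sup>2 + 1)) \<le> real n / 1"
        using zero_le_power2[of C] C2 by (intro divide_left_mono) auto
      also have "\<dots> \<le> real n * t" using t1 mult_left_mono[of 1 t "real n"] by simp
      finally show "real n / (2 * (C\<^sup>2 + 1)) \<le> real n * t" .
    qed
    also have "\<dots> \<le> R" unfolding R_def using t1 by simp
    finally show "\<delta> \<le> R" .
    show "separated m X \<delta> (f ` \<F>)"
      unfolding separated_def
    proof (intro ballI allI impI)
      fix g g' u B
      assume g: "g \<in> f ` \<F>" "g' \<in> f ` \<F>" "g \<noteq> g'" and u: "u \<in> trig_span d M"
        "\<forall>j<m. u (X j) = g (X j) - g' (X j)" "\<forall>x\<in>space (torus d). cmod (u x) \<le> B"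
      obtain I J where "g = f I" "I \<in> \<F>" "g' = f J" "J \<in> \<F>" using g(1,2) by (elim imageE)
      with g(3) u show "\<delta> \<le> B" by (intro key[of I J u]) auto
    qed
  qed (rule \<delta>)
  \<comment> \<open>The roots of n cancel.\<close>
  also have "8 * R / \<delta> = 56 * (sqrt t * sqrt (2 * (C\<^sup>2 + 1)))"
    using \<open>n \<ge> 1\<close> by (simp add: R_def \<delta>_def real_sqrt_mult real_sqrt_divide)
  also have "(56 * (sqrt t * sqrt (2 * (C\<^sup>2 + 1)))) ^ (2 * m) \<le> (112 * (C + 1) * t) ^ (2 * m)"
  proof (rule power_mono)
    \<comment> \<open>As t \<ge> 1, its root may be replaced by t, and the root of 2 (C^2 + 1) by 2
      (C + 1); thus 56 becomes 112.\<close>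
    have "t * 1 \<le> t * t" using t1 by (intro mult_left_mono) auto
    then have "sqrt t \<le> t" using t1 by (intro real_le_lsqrt) (auto simp: power2_eq_square)
    moreover have "sqrt (2 * (C\<^sup>2 + 1)) \<le> 2 * (C + 1)"
      using \<open>C > 0\<close> by (intro real_le_lsqrt) (auto simp: power2_eq_square algebra_simps)
    ultimately have "sqrt t * sqrt (2 * (C\<^sup>2 + 1)) \<le> t * (2 * (C + 1))"
      using t1 by (intro mult_mono) auto
    then show "56 * (sqrt t * sqrt (2 * (C\<^sup>2 + 1))) \<le> 112 * (C + 1) * t" by (simp add: algebra_simps)
  qed (use t1 in auto)
  finally have "real (card \<F>) \<le> (112 * (C + 1) * t) ^ (2 * m)"
    using inj by (simp add: card_image)
  with large show ?thesis by (simp add: t_def)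
qed

theorem theorem4p3:
  fixes C :: real
  assumes "C > 0"
  shows "\<exists>C'>0. \<forall>(d::nat) (M::nat) (m::nat) (X :: nat \<Rightarrow> nat \<Rightarrow> real) (Y :: torus_fun \<Rightarrow> real)
           (T :: (nat \<Rightarrow> complex) \<Rightarrow> torus_fun).
    d \<ge> 1 \<longrightarrow> M \<ge> 1 \<longrightarrow>
    X \<in> {..<m} \<rightarrow> ({..<d} \<rightarrow>\<^sub>E {0..1}) \<longrightarrow>
    norm_on_continuous d Y \<longrightarrow>
    T \<in> ({..<m} \<rightarrow>\<^sub>E UNIV) \<rightarrow> torus_L2 d \<longrightarrow>
    (\<forall>f\<in>torus_continuous d. \<forall>n\<ge>1.
       L2_norm d (\<lambda>x. f x - T (samples m X f) x)
         \<le> C * (best_term_approx d (2 * n) f + best_cube_approx d M Y f)) \<longrightarrow>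
    (\<forall>n\<ge>1. let N = (2 * real M + 1) ^ d in
       real m \<ge> real n * (ln (N / (4 * real n)) / (4 * ln (C' * real d * ln N))))"
\<comment> \<open>The witness is the factor of d ln N in \<open>packing_number_le\<close>.\<close>
proof (intro exI[of _ "112 * (C + 1)"] conjI allI impI)
  show "112 * (C + 1) > 0" using assms by simp
  fix d M m X Y T and n :: nat
  assume d: "d \<ge> 1" and M: "M \<ge> 1" and X: "X \<in> {..<m} \<rightarrow> ({..<d} \<rightarrow>\<^sub>E {0..1})"
    and Y: "norm_on_continuous d Y" and T: "T \<in> ({..<m} \<rightarrow>\<^sub>E UNIV) \<rightarrow> torus_L2 d"
    and rec: "\<forall>f\<in>torus_continuous d. \<forall>n\<ge>1.
       L2_norm d (\<lambda>x. f x - T (samples m X f) x)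
         \<le> C * (best_term_approx d (2 * n) f + best_cube_approx d M Y f)"
    and n: "n \<ge> 1"
  define N where "N = (2 * real M + 1) ^ d"
  define A where "A = 112 * (C + 1) * (real d * ln N)"
  have "3 ^ 1 \<le> (3::real) ^ d" using d by (intro power_increasing) auto
  also have "\<dots> \<le> N" unfolding N_def using M by (intro power_mono) auto
  finally have N: "N \<ge> 3" by simp
  then have "real d * ln N \<ge> 1"
    using sup_radius_le(2)[of d M 1] d M by (simp add: N_def)
  then have "112 * (C + 1) * 1 \<le> A"
    unfolding A_def using assms by (intro mult_left_mono) auto
  moreover have "112 * (C + 1) * 1 > 1" using assms by simp
  ultimately have A: "A > 1" by (rule less_le_trans[rotated])
  then have lnA: "ln A > 0" by simp
  have "real n * (ln (N / (4 * real n)) / (4 * ln A)) \<le> real m"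
  proof (cases "real n \<le> N")
    case True
    have "L2_norm d h \<le> C * best_term_approx d (2 * n) h"
      if "h \<in> trig_span d M" "\<And>j. j < m \<Longrightarrow> h (X j) = 0" for h
      using rec n by (intro null_space_property[OF assms Y T _ that]) auto
    then have "(N / (4 * real n)) powr (real n / 2) \<le> A ^ (2 * m)"
      unfolding A_def N_def
      using assms d M n True X by (intro packing_number_le) (auto simp: N_def)
    then have "ln ((N / (4 * real n)) powr (real n / 2)) \<le> ln (A ^ (2 * m))"
      using N n by (intro ln_mono) auto
    \<comment> \<open>The factors 1/2 on the left and 2 on the right combine to the 4 in the
      claim.\<close>
    then have "real n / 2 * ln (N / (4 * real n)) \<le> 2 * real m * ln A"
      using N n A by (simp add: ln_powr ln_realpow)
    then show ?thesis using lnA by (simp add: field_simps)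
  next
    \<comment> \<open>The cube has fewer than n frequencies, so no family exists; but the logarithm
      in the numerator is then not positive, while ln A is.\<close>
    case False
    then have "N / (4 * real n) \<le> 1" using N n by simp
    then have "ln (N / (4 * real n)) \<le> 0" using N n by simp
    then have "real n * (ln (N / (4 * real n)) / (4 * ln A)) \<le> 0"
      using lnA by (intro mult_nonneg_nonpos divide_nonpos_pos) auto
    then show ?thesis by linarith
  qed
  then show "let N = (2 * real M + 1) ^ d in
       real m \<ge> real n * (ln (N / (4 * real n)) / (4 * ln (112 * (C + 1) * real d * ln N)))"
    by (simp add: Let_def A_def N_def mult.assoc)
qed

end
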